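(* Let $\mu$ be a shift-invariant $r$-step Markov probability measure on $A^{\mathbb Z}$, $r\ge 1$, where $A$ is a finite alphabet, and let $X$ be the support of $\mu$, where every letter of $A$ is assumed to occur in some element of $X$. Let $\varphi\colon A^*\to G$ be a (monoid) morphism onto a finite group $G$ with uniform probability measure $\nu$. If $X$ is $\varphi$-irreducible, then the product measure $\nu\times\mu$ is ergodic on the skew product $G\rtimes_\varphi X$. In particular, for every $K\subseteq G$, the language $L=\varphi^{-1}(K)$ has density $\delta_\mu(L)=|K|/|G|$.
   Context: $S$ denotes the shift map $S((x_n)_n)=(x_{n+1})_n$ on $A^{\mathbb Z}$. For $x\in A^{\mathbb Z}$ (or a finite word) and $i\le j$, $x_{[i,j)}=x_i x_{i+1}\cdots x_{j-1}$. A measure $\mu$ on $A^{\mathbb Z}$ is an $r$-step Markov measure if for every word $w=w_0\cdots w_{m-1}\in A^*$ of length $m\ge r$ with $\mu(x_{[0,m)}=w)\neq0$ and every $a\in A$, $\mu(x_m=a\mid x_{[0,m)}=w)=\mu(x_m=a\mid x_{[m-r,m)}=w_{[m-r,m)})$. The language $\mathcal L(X)$ is the set of all finite words $x_{[i,j)}$ with $x\in X$, $i\le j$ (including the empty word). $X$ is $\varphi$-irreducible if for all $u,v\in\mathcal L(X)$ there exists $w\in A^*$ such that $uwv\in\mathcal L(X)$ and $\varphi(uw)=1_G$. The skew product $G\rtimes_\varphi X$ is the dynamical system $(G\times X,T_\varphi)$, $G$ discrete, with $T_\varphi(g,x)=(g\varphi(x_0),Sx)$. The density of $L\subseteq A^*$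 is $\delta_\mu(L)=\lim_{n\to\infty}\frac1n\sum_{i=0}^{n-1}\mu(\{x\in X: x_{[0,i)}\in L\})$. *)

theory Defs
  imports "HOL-Probability.Probability" "HOL-Algebra.Group"
begin

abbreviation full_shift :: "(int \<Rightarrow> 'a) measure" where
  "full_shift \<equiv> PiM UNIV (\<lambda>_. count_space UNIV)"

definition shift_map :: "(int \<Rightarrow> 'a) \<Rightarrow> (int \<Rightarrow> 'a)" where
  "shift_map x = (\<lambda>n. x (n + 1))"

definition factor :: "(int \<Rightarrow> 'a) \<Rightarrow> int \<Rightarrow> int \<Rightarrow> 'a list" where
  "factor x i j = map x [i..j - 1]"

definition invariant_under :: "'b measure \<Rightarrow> ('b \<Rightarrow> 'b) \<Rightarrow> bool" where
  "invariant_under M T \<longleftrightarrow> T \<in> measurable M M \<and> distr M M T = M"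

definition ergodic :: "'b measure \<Rightarrow> ('b \<Rightarrow> 'b) \<Rightarrow> bool" where
  "ergodic M T \<longleftrightarrow> prob_space M \<and> invariant_under M T \<and>
     (\<forall>B\<in>sets M. T -` B \<inter> space M = B \<longrightarrow> measure M B = 0 \<or> measure M B = 1)"

text \<open>The topological support, for the product of the discrete topologies on the alphabet.\<close>

definition measure_support :: "(int \<Rightarrow> 'a) measure \<Rightarrow> (int \<Rightarrow> 'a) set" where
  "measure_support M =
     {x. \<forall>U. openin (product_topology (\<lambda>_. discrete_topology UNIV) UNIV) U \<and> x \<in> U
           \<longrightarrow> emeasure M U > 0}"

definition markov_measure :: "nat \<Rightarrow> (int \<Rightarrow> 'a) measure \<Rightarrow> bool" where
  "markov_measure r M \<longleftrightarrow>
     (\<forall>w a m. m = length w \<and> m \<ge> r \<and> \<P>(x in M. factor x 0 (int m) = w) \<noteq> 0 \<longrightarrow>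
        \<P>(x in M. x (int m) = a \<bar> factor x 0 (int m) = w) =
        \<P>(x in M. x (int m) = a \<bar> factor x (int m - int r) (int m) = drop (m - r) w))"

definition language :: "(int \<Rightarrow> 'a) set \<Rightarrow> 'a list set" where
  "language X = {factor x i j | x i j. x \<in> X \<and> i \<le> j}"

definition word_monoid :: "'a list monoid" where
  "word_monoid = \<lparr>carrier = UNIV, mult = (@), one = []\<rparr>"

definition morphism_irreducible ::
    "('g, 'b) monoid_scheme \<Rightarrow> ('a list \<Rightarrow> 'g) \<Rightarrow> (int \<Rightarrow> 'a) set \<Rightarrow> bool" where
  "morphism_irreducible G \<phi> X \<longleftrightarrow>
     (\<forall>u\<in>language X. \<forall>v\<in>language X. \<exists>w. u @ w @ v \<in> language X \<and> \<phi> (u @ w) = \<one>\<^bsub>G\<^esub>)"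

definition skew_map ::
    "('g, 'b) monoid_scheme \<Rightarrow> ('a list \<Rightarrow> 'g) \<Rightarrow> 'g \<times> (int \<Rightarrow> 'a) \<Rightarrow> 'g \<times> (int \<Rightarrow> 'a)" where
  "skew_map G \<phi> = (\<lambda>(g, x). (g \<otimes>\<^bsub>G\<^esub> \<phi> [x 0], shift_map x))"

definition skew_measure ::
    "('g, 'b) monoid_scheme \<Rightarrow> (int \<Rightarrow> 'a) measure \<Rightarrow> ('g \<times> (int \<Rightarrow> 'a)) measure" where
  "skew_measure G M =
     uniform_count_measure (carrier G) \<Otimes>\<^sub>M restrict_space M (measure_support M)"

text \<open>\<^term>\<open>has_language_density M L d\<close> asserts both that the limit defining the density of
  \<^term>\<open>L\<close> exists and that its value is \<^term>\<open>d\<close>.\<close>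

definition has_language_density ::
    "(int \<Rightarrow> 'a) measure \<Rightarrow> 'a list set \<Rightarrow> real \<Rightarrow> bool" where
  "has_language_density M L d \<longleftrightarrow>
     (\<lambda>n. (1 / real n) * (\<Sum>i<n. measure M {x \<in> measure_support M. factor x 0 (int i) \<in> L}))
       \<longlonglongrightarrow> d"

end

theory Submission
  imports Defs
begin

text \<open>Let \<open>T\<close> be the skew product map and \<open>m\<close> the product measure. A cylinder \<open>{g} \<times> [s]\<close> with
  \<open>length s = R \<ge> r\<close> is a state of a finite Markov chain moving as
  \<open>(g, s) \<mapsto> (g \<phi>(s\<^sub>0), s\<^sub>1 \<cdots> s\<^bsub>R-1\<^esub> b)\<close>, and \<open>\<phi>\<close>-irreducibility together with surjectivity of \<open>\<phi>\<close>
  makes this chain irreducible. By the maximum principle the Cesaro averages of \<open>m(C \<inter> T\<^sup>-\<^sup>n D)\<close> then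
  converge to \<open>m(C) m(D)\<close> for cylinders, hence by a \<open>\<pi>\<close>-\<open>\<lambda>\<close> argument in each variable for all
  measurable \<open>C\<close>, \<open>D\<close>. Taking \<open>C = D\<close> invariant gives ergodicity; taking \<open>C = {1} \<times> X\<close> and
  \<open>D = K \<times> X\<close> gives the density.\<close>

section \<open>Cesaro averages and mixing\<close>

text \<open>Averages are needed because the chain may be periodic. On a Bernoulli shift with
  \<open>\<phi>\<close> the word length modulo 2, irreducibility holds, yet for C = {0} x X the
  numbers m(C \<inter> T^-n C) alternate between 1/2 and 0. A state keeps at least r letters because
  past and future are independent given such a block. The group coordinate can be carried along
  because T only multiplies it by the image of the letter that leaves the block. Irreducibility is a
  statement about the language of X, the chain is one about probabilities. They meet because the
  language of the support consists exactly of the words of positive probability. The chain sees only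
  the coordinates from 0 on. Since T preserves m, a two-sided cylinder can be pulled back by a power
  of T until it too involves only these.\<close>

definition cesaro_to :: "(nat \<Rightarrow> real) \<Rightarrow> real \<Rightarrow> bool" where
  "cesaro_to a l \<longleftrightarrow> (\<lambda>n. (1 / real n) * (\<Sum>i<n. a i)) \<longlonglongrightarrow> l"

lemma cesaro_to_const: "cesaro_to (\<lambda>_. c) c"
proof -
  have "(\<lambda>n. (1 / real n) * (\<Sum>i<n. c)) \<longlonglongrightarrow> c"
    by (rule tendsto_eventually, rule eventually_mono[OF eventually_gt_at_top[of 0]]) simp
  then show ?thesis
    by (simp add: cesaro_to_def)
qed

lemma cesaro_to_unique: "cesaro_to a l \<Longrightarrow> cesaro_to a l' \<Longrightarrow> l = l'"
  unfolding cesaro_to_def by (rule LIMSEQ_unique)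

lemma cesaro_to_diff:
  assumes "cesaro_to a l" "cesaro_to b l'"
  shows "cesaro_to (\<lambda>n. a n - b n) (l - l')"
  using tendsto_diff[OF assms[unfolded cesaro_to_def]]
  by (simp add: cesaro_to_def sum_subtractf right_diff_distrib)

lemma cesaro_to_cmult:
  assumes "cesaro_to a l"
  shows "cesaro_to (\<lambda>n. c * a n) (c * l)"
  using tendsto_mult_left[OF assms[unfolded cesaro_to_def], of c]
  by (simp add: cesaro_to_def mult.left_commute flip: sum_distrib_left)

lemma cesaro_to_sum:
  assumes "\<And>k. k \<in> I \<Longrightarrow> cesaro_to (a k) (l k)"
  shows "cesaro_to (\<lambda>n. \<Sum>k\<in>I. a k n) (\<Sum>k\<in>I. l k)"
proof -
  have "(\<lambda>n. \<Sum>k\<in>I. (1 / real n) * (\<Sum>i<n. a k i)) \<longlonglongrightarrow> (\<Sum>k\<in>I. l k)"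
    using assms by (intro tendsto_sum) (simp add: cesaro_to_def)
  moreover have "(\<Sum>k\<in>I. (1 / real n) * (\<Sum>i<n. a k i)) = (1 / real n) * (\<Sum>i<n. \<Sum>k\<in>I. a k i)" for n
    by (subst sum.swap) (simp add: sum_distrib_left)
  ultimately show ?thesis
    by (simp add: cesaro_to_def)
qed

text \<open>Tannery's theorem, that is, dominated convergence for series: the averages of
  \<open>a k\<close> inherit the bound \<open>B k\<close>, which does not depend on n. This carries
  Cesaro limits through countable disjoint unions.\<close>

lemma cesaro_to_suminf:
  fixes a :: "nat \<Rightarrow> nat \<Rightarrow> real"
  assumes lim: "\<And>k. cesaro_to (a k) (l k)"
    and bound: "\<And>k n. \<bar>a k n\<bar> \<le> B k" and "summable B"
  shows "cesaro_to (\<lambda>n. \<Sum>k. a k n) (\<Sum>k. l k)"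
proof -
  have avg: "\<bar>(1 / real n) * (\<Sum>i<n. a k i)\<bar> \<le> B k" for k n
  proof (cases "n = 0")
    case True
    have "0 \<le> B k"
      using bound[of k 0] by linarith
    then show ?thesis
      using True by simp
  next
    case False
    have "\<bar>\<Sum>i<n. a k i\<bar> \<le> (\<Sum>i<n. B k)"
      using bound by (intro order_trans[OF sum_abs] sum_mono)
    then show ?thesis
      using False by (simp add: abs_mult field_simps)
  qed
  have "(\<lambda>n. \<Sum>k. (1 / real n) * (\<Sum>i<n. a k i)) \<longlonglongrightarrow> (\<Sum>k. l k)"
    using tannerys_theorem[of "\<lambda>k n. (1 / real n) * (\<Sum>i<n. a k i)" l sequentially B]
      lim avg \<open>summable B\<close>
    by (simp only: cesaro_to_def real_norm_def case_prod_unfold eventually_True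
        sequentially_bot not_False_eq_True simp_thms)
  moreover have sm: "summable (\<lambda>k. a k i)" for i
    using bound by (intro summable_comparison_test'[OF \<open>summable B\<close>, of 0]) simp
  have "(\<Sum>k. (1 / real n) * (\<Sum>i<n. a k i)) = (1 / real n) * (\<Sum>i<n. \<Sum>k. a k i)" for n
    using sm by (subst suminf_mult, intro summable_sum) (auto simp: suminf_sum)
  ultimately show ?thesis
    by (simp add: cesaro_to_def)
qed

text \<open>The sets \<open>D\<close> with the asserted limit form a Dynkin system; domination by
  \<open>measure M\<close> supplies the summable bound needed for disjoint unions. The set function
  is left abstract so that either argument of m(C \<inter> T^-n D) can be the varying one, with
  \<open>c\<close> the measure of the other.\<close>

lemma cesaro_to_generator:
  fixes \<nu> :: "nat \<Rightarrow> 'b set \<Rightarrow> real"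
  assumes fin: "finite_measure M"
    and gen: "Int_stable A" "A \<subseteq> Pow (space M)" "sets M = sigma_sets (space M) A"
    and union: "\<And>n F. range F \<subseteq> sets M \<Longrightarrow> disjoint_family F \<Longrightarrow>
      (\<lambda>i::nat. \<nu> n (F i)) sums \<nu> n (\<Union>i. F i)"
    and compl: "\<And>n D. D \<in> sets M \<Longrightarrow> \<nu> n (space M - D) = \<nu> n (space M) - \<nu> n D"
    and bound: "\<And>n D. D \<in> sets M \<Longrightarrow> 0 \<le> \<nu> n D \<and> \<nu> n D \<le> measure M D"
    and space: "cesaro_to (\<lambda>n. \<nu> n (space M)) (c * measure M (space M))"
    and basic: "\<And>D. D \<in> A \<Longrightarrow> cesaro_to (\<lambda>n. \<nu> n D) (c * measure M D)"
    and D: "D \<in> sets M"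
  shows "cesaro_to (\<lambda>n. \<nu> n D) (c * measure M D)"
  using gen(1,2) D[unfolded gen(3)]
proof (induction rule: sigma_sets_induct_disjoint)
  case (basic D)
  then show ?case
    by (rule assms)
next
  case empty
  have "\<nu> n {} = 0" for n
    using bound[of "{}" n] by simp
  then show ?case
    by (simp add: cesaro_to_const)
next
  case (compl D)
  then have D: "D \<in> sets M"
    using gen by simp
  show ?case
    using cesaro_to_diff[OF space compl.IH]
    by (simp add: assms(6)[OF D] finite_measure.finite_measure_compl[OF fin D] right_diff_distrib)
next
  case (union F)
  then have F: "range F \<subseteq> sets M"
    using gen by simp
  have m: "(\<lambda>i. measure M (F i)) sums measure M (\<Union>i. F i)"
    by (rule finite_measure.finite_measure_UNION[OF fin F union.hyps(1)])
  have "cesaro_to (\<lambda>n. \<Sum>k. \<nu> n (F k)) (\<Sum>k. c * measure M (F k))"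
    using bound[OF subsetD[OF F rangeI]]
    by (intro cesaro_to_suminf[OF union.IH _ sums_summable[OF m]]) simp
  then show ?case
    using sums_unique[OF assms(5)[OF F union.hyps(1)]] sums_unique[OF m] sums_summable[OF m]
    by (simp add: suminf_mult)
qed

section \<open>Invariant maps: from mixing on a generator to ergodicity\<close>

lemma measurable_funpow: "T \<in> measurable M M \<Longrightarrow> (T ^^ n) \<in> measurable M M"
  by (induction n) (auto simp: id_def intro: measurable_comp)

lemma invariant_under_measure_vimage:
  assumes "invariant_under M T" "E \<in> sets M"
  shows "measure M (T -` E \<inter> space M) = measure M E"
  using assms measure_distr[of T M M E] by (simp add: invariant_under_def)

lemma invariant_under_funpow:
  assumes "invariant_under M T"
  shows "invariant_under M (T ^^ n)"
proof (induction n)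
  case 0
  then show ?case
    by (simp add: invariant_under_def id_def distr_id)
next
  case (Suc n)
  then show ?case
    using assms distr_distr[of T M M "T ^^ n" M] measurable_comp[of "T ^^ n" M M T M]
    by (simp add: invariant_under_def comp_def)
qed

text \<open>Two passes of the generator argument. With \<open>C\<close> in the generator fixed,
  \<open>D\<close> varies, and the domination comes from invariance, m(T^-n D) = m(D). With a
  measurable \<open>D\<close> fixed, \<open>C\<close> varies, and the domination is plain
  monotonicity.\<close>

lemma cesaro_mixing_generator:
  assumes M: "prob_space M" and T: "invariant_under M T"
    and gen: "Int_stable A" "A \<subseteq> Pow (space M)" "sets M = sigma_sets (space M) A"
    and basic: "\<And>C D. C \<in> A \<Longrightarrow> D \<in> A \<Longrightarrow>
      cesaro_to (\<lambda>n. measure M (C \<inter> (T ^^ n) -` D)) (measure M C * measure M D)"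
    and C: "C \<in> sets M" and D: "D \<in> sets M"
  shows "cesaro_to (\<lambda>n. measure M (C \<inter> (T ^^ n) -` D)) (measure M C * measure M D)"
proof -
  interpret prob_space M
    by (rule M)
  have Tn: "(T ^^ n) \<in> measurable M M" for n
    using T by (intro measurable_funpow) (simp add: invariant_under_def)
  have meas: "C \<inter> (T ^^ n) -` D \<in> sets M" if "C \<in> sets M" "D \<in> sets M" for C D n
  proof -
    have "C \<inter> (T ^^ n) -` D = C \<inter> ((T ^^ n) -` D \<inter> space M)"
      using sets.sets_into_space[OF that(1)] by auto
    then show ?thesis
      using that measurable_sets[OF Tn that(2)] by auto
  qed
  have le: "measure M (C \<inter> (T ^^ n) -` D) \<le> measure M D" if "C \<in> sets M" "D \<in> sets M" for C D n
  proof -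
    have "measure M (C \<inter> (T ^^ n) -` D) \<le> measure M ((T ^^ n) -` D \<inter> space M)"
      using that measurable_sets[OF Tn that(2)] sets.sets_into_space[OF that(1)]
      by (intro finite_measure_mono) auto
    then show ?thesis
      using invariant_under_measure_vimage[OF invariant_under_funpow[OF T] that(2)] by simp
  qed
  have inspace: "C \<inter> (T ^^ n) -` space M = C" if "C \<in> sets M" for C n
    using sets.sets_into_space[OF that] measurable_space[OF Tn] by blast
  have step: "cesaro_to (\<lambda>n. measure M (C \<inter> (T ^^ n) -` D)) (measure M C * measure M D)"
    if CA: "C \<in> A" and D: "D \<in> sets M" for C D
  proof -
    have C: "C \<in> sets M"
      using CA gen by auto
    show ?thesis
    proof (rule cesaro_to_generator[OF finite_measure_axioms gen _ _ _ _ _ D,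
          where \<nu> = "\<lambda>n D. measure M (C \<inter> (T ^^ n) -` D)"])
      fix n and F :: "nat \<Rightarrow> 'a set"
      assume F: "range F \<subseteq> sets M" "disjoint_family F"
      have "(\<lambda>i. measure M (C \<inter> (T ^^ n) -` F i)) sums measure M (\<Union>i. C \<inter> (T ^^ n) -` F i)"
        using F meas[OF C] by (intro finite_measure_UNION) (auto simp: disjoint_family_on_def)
      then show "(\<lambda>i. measure M (C \<inter> (T ^^ n) -` F i)) sums measure M (C \<inter> (T ^^ n) -` (\<Union>i. F i))"
        by (simp only: vimage_UN Int_UN_distrib)
    next
      fix n and D assume D: "D \<in> sets M"
      have "C \<inter> (T ^^ n) -` (space M - D) = C - C \<inter> (T ^^ n) -` D"
        using inspace[OF C, of n] by blast
      then show "measure M (C \<inter> (T ^^ n) -` (space M - D))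
          = measure M (C \<inter> (T ^^ n) -` space M) - measure M (C \<inter> (T ^^ n) -` D)"
        using finite_measure_Diff[OF C meas[OF C D]] inspace[OF C, of n] by simp
    qed (use C CA basic inspace le in \<open>auto simp: prob_space cesaro_to_const\<close>)
  qed
  \<comment> \<open>Second pass; the factors are swapped because the constant \<open>c\<close> is
    now the measure of \<open>D\<close>.\<close>
  have "cesaro_to (\<lambda>n. measure M (C \<inter> (T ^^ n) -` D)) (measure M D * measure M C)"
  proof (rule cesaro_to_generator[OF finite_measure_axioms gen _ _ _ _ _ C,
        where \<nu> = "\<lambda>n C. measure M (C \<inter> (T ^^ n) -` D)"])
    fix n and F :: "nat \<Rightarrow> 'a set"
    assume F: "range F \<subseteq> sets M" "disjoint_family F"
    have "(\<lambda>i. measure M (F i \<inter> (T ^^ n) -` D)) sums measure M (\<Union>i. F i \<inter> (T ^^ n) -` D)"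
      using F meas[OF _ D] by (intro finite_measure_UNION) (auto simp: disjoint_family_on_def)
    then show "(\<lambda>i. measure M (F i \<inter> (T ^^ n) -` D)) sums measure M ((\<Union>i. F i) \<inter> (T ^^ n) -` D)"
      by (simp only: UN_simps)
  next
    fix n and C assume C: "C \<in> sets M"
    have eq: "(space M - C) \<inter> (T ^^ n) -` D = space M \<inter> (T ^^ n) -` D - C \<inter> (T ^^ n) -` D"
      by blast
    show "measure M ((space M - C) \<inter> (T ^^ n) -` D)
        = measure M (space M \<inter> (T ^^ n) -` D) - measure M (C \<inter> (T ^^ n) -` D)"
      unfolding eq using sets.sets_into_space[OF C]
      by (intro finite_measure_Diff meas C D sets.top) auto
  next
    fix n and C assume C: "C \<in> sets M"
    show "0 \<le> measure M (C \<inter> (T ^^ n) -` D) \<and> measure M (C \<inter> (T ^^ n) -` D) \<le> measure M C"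
      using C by (auto intro: finite_measure_mono)
  next
    show "cesaro_to (\<lambda>n. measure M (space M \<inter> (T ^^ n) -` D)) (measure M D * measure M (space M))"
      using invariant_under_measure_vimage[OF invariant_under_funpow[OF T] D]
      by (simp add: prob_space cesaro_to_const Int_commute)
  qed (use step D in \<open>auto simp: mult.commute\<close>)
  then show ?thesis
    by (simp add: mult.commute)
qed

lemma cesaro_mixing_imp_ergodic:
  assumes M: "prob_space M" and T: "invariant_under M T"
    and mix: "\<And>C D. C \<in> sets M \<Longrightarrow> D \<in> sets M \<Longrightarrow>
      cesaro_to (\<lambda>n. measure M (C \<inter> (T ^^ n) -` D)) (measure M C * measure M D)"
  shows "ergodic M T"
  unfolding ergodic_def
proof (intro conjI M T ballI impI)
  fix B assume B: "B \<in> sets M" and inv: "T -` B \<inter> space M = B"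
  have "(T ^^ n) z \<in> B" if "z \<in> B" for n z
    using that inv by (induction n) auto
  then have "B \<inter> (T ^^ n) -` B = B" for n
    by auto
  then have "measure M B = measure M B * measure M B"
    using mix[OF B B] by (intro cesaro_to_unique[OF cesaro_to_const]) simp
  then show "measure M B = 0 \<or> measure M B = 1"
    by simp
qed

text \<open>A maximum principle for the averages \<open>a n\<close> of \<open>f\<close>: they are harmonic up to an error \<open>O(1/n)\<close>,
  so along a path leaving a maximiser of \<open>a n\<close> the defect \<open>Max (a n) - a n\<close> stays \<open>O(1/n)\<close>.\<close>

lemma cesaro_to_irreducible_chain:
  fixes f :: "nat \<Rightarrow> 'q \<Rightarrow> real" and p :: "'q \<Rightarrow> 'b::finite \<Rightarrow> real" and \<delta> :: "'q \<Rightarrow> 'b \<Rightarrow> 'q"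
  assumes fin: "finite Q"
    and nonneg: "\<And>q b. q \<in> Q \<Longrightarrow> p q b \<ge> 0"
    and stoch: "\<And>q. q \<in> Q \<Longrightarrow> (\<Sum>b\<in>UNIV. p q b) = 1"
    and closed: "\<And>q b. q \<in> Q \<Longrightarrow> p q b > 0 \<Longrightarrow> \<delta> q b \<in> Q"
    and irred: "\<And>q q'. q \<in> Q \<Longrightarrow> q' \<in> Q \<Longrightarrow> (q, q') \<in> {(q, \<delta> q b) | q b. q \<in> Q \<and> p q b > 0}\<^sup>*"
    and step: "\<And>n q. q \<in> Q \<Longrightarrow> f (Suc n) q = (\<Sum>b\<in>UNIV. p q b * f n (\<delta> q b))"
    and bound: "\<And>n q. q \<in> Q \<Longrightarrow> \<bar>f n q\<bar> \<le> 1"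
    and weight: "(\<Sum>q\<in>Q. \<pi> q) \<noteq> 0"
    and inv: "\<And>n. (\<Sum>q\<in>Q. \<pi> q * f n q) = c"
    and q: "q \<in> Q"
  shows "cesaro_to (\<lambda>n. f n q) (c / (\<Sum>q\<in>Q. \<pi> q))"
proof -
  define a where "a n q = (1 / real n) * (\<Sum>i<n. f i q)" for n q
  define top where "top n = Max (a n ` Q)" for n
  define d where "d n q = top n - a n q" for n q
  \<comment> \<open>Shifting the average by one time step telescopes to an error
    \<open>(f n q - f 0 q) / n\<close>, and both values are at most 1 in modulus; hence the
    2.\<close>
  define e where "e n = 2 / real n" for n
  have e0: "0 \<le> e n" for n
    by (simp add: e_def)
  have d0: "0 \<le> d n q" if "q \<in> Q" for n q
    using that fin by (simp add: d_def top_def)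
  have harm: "(\<Sum>b\<in>UNIV. p q b * d n (\<delta> q b)) \<le> d n q + e n" if q: "q \<in> Q" for n q
  proof -
    have "(\<Sum>b\<in>UNIV. p q b * a n (\<delta> q b)) = (1 / real n) * (\<Sum>i<n. f (Suc i) q)"
      by (simp add: a_def step[OF q] sum_distrib_left mult_ac)
         (subst sum.swap, simp add: mult_ac)
    also have "(\<Sum>i<n. f (Suc i) q) = (\<Sum>i<n. f i q) + f n q - f 0 q"
      using sum_lessThan_telescope[of "\<lambda>i. f i q" n] by (simp add: sum_subtractf)
    also have "(1 / real n) * \<dots> = a n q + (f n q - f 0 q) / real n"
      by (simp add: a_def field_simps add_divide_distrib diff_divide_distrib)
    finally have avg: "(\<Sum>b\<in>UNIV. p q b * a n (\<delta> q b)) = a n q + (f n q - f 0 q) / real n" .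
    have "(f n q - f 0 q) / real n \<ge> - e n"
    proof -
      have "- 2 / real n \<le> (f n q - f 0 q) / real n"
        using bound[OF q, of n] bound[OF q, of 0] by (intro divide_right_mono) auto
      then show ?thesis
        by (simp add: e_def)
    qed
    then have "a n q - e n \<le> (\<Sum>b\<in>UNIV. p q b * a n (\<delta> q b))"
      by (simp add: avg)
    moreover have "(\<Sum>b\<in>UNIV. p q b * d n (\<delta> q b)) = top n - (\<Sum>b\<in>UNIV. p q b * a n (\<delta> q b))"
      using stoch[OF q]
      by (simp add: d_def right_diff_distrib sum_subtractf flip: sum_distrib_right)
    ultimately show ?thesis
      by (simp add: d_def)
  qed
  have edge: "p q b * d n (\<delta> q b) \<le> d n q + e n" if q: "q \<in> Q" and b: "p q b > 0" for n q b
  proof -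
    \<comment> \<open>A successor of probability 0 may lie outside \<open>Q\<close>, where the
      defect has no known sign; the factor 0 removes it.\<close>
    have "0 \<le> p q b' * d n (\<delta> q b')" for b'
      using nonneg[OF q, of b'] closed[OF q, of b'] d0[of "\<delta> q b'" n]
      by (cases "p q b' = 0") auto
    then have "p q b * d n (\<delta> q b) \<le> (\<Sum>b\<in>UNIV. p q b * d n (\<delta> q b))"
      by (intro member_le_sum) auto
    then show ?thesis
      using harm[OF q] by (rule order_trans)
  qed
  have path: "\<exists>K. \<forall>n. d n q' \<le> K * (d n q + e n)" if q: "q \<in> Q" and q': "q' \<in> Q" for q q'
    using irred[OF q q']
  proof (induction rule: rtrancl_induct)
    case base
    show ?case
      using e0 by (intro exI[of _ 1]) simp
  next
    case (step q1 q2)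
    then obtain K b where K: "\<And>n. d n q1 \<le> K * (d n q + e n)"
      and q1: "q1 \<in> Q" "q2 = \<delta> q1 b" "p q1 b > 0"
      by auto
    \<comment> \<open>Each edge costs one more error \<open>e n\<close> and a division by its
      probability. The constant depends on the path but not on n.\<close>
    have "d n q2 \<le> (K + 1) / p q1 b * (d n q + e n)" for n
    proof -
      have "p q1 b * d n q2 \<le> d n q1 + e n"
        using edge[OF q1(1,3)] q1(2) by simp
      also have "\<dots> \<le> (K + 1) * (d n q + e n)"
        using K[of n] d0[OF q, of n] by (simp add: algebra_simps)
      finally show ?thesis
        using q1(3) by (simp add: field_simps)
    qed
    then show ?case
      by blast
  qed
  have dto0: "(\<lambda>n. d n q') \<longlonglongrightarrow> 0" if q': "q' \<in> Q" for q'
  proof -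
    obtain K where K: "\<And>q n. q \<in> Q \<Longrightarrow> d n q' \<le> K q * (d n q + e n)"
      using path[OF _ q'] by metis
    \<comment> \<open>The maximiser \<open>q\<close> has defect 0 but changes with n, so the path
      constants are summed over all possible starting states to get a single one.\<close>
    have upper: "d n q' \<le> (\<Sum>q\<in>Q. \<bar>K q\<bar>) * e n" for n
    proof -
      have "top n \<in> a n ` Q"
        unfolding top_def using fin q' by (intro Max_in) auto
      then obtain q where q: "q \<in> Q" "d n q = 0"
        by (auto simp: d_def)
      have "d n q' \<le> K q * e n"
        using K[OF q(1), of n] q(2) by simp
      also have "\<dots> \<le> (\<Sum>q\<in>Q. \<bar>K q\<bar>) * e n"
        using e0 q(1) fin
        by (intro mult_right_mono order_trans[OF abs_ge_self member_le_sum[of q Q "\<lambda>q. \<bar>K q\<bar>"]]) auto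
      finally show ?thesis .
    qed
    have "(\<lambda>n. (\<Sum>q\<in>Q. \<bar>K q\<bar>) * e n) \<longlonglongrightarrow> 0"
      unfolding e_def by (intro tendsto_mult_right_zero lim_const_over_n)
    then show ?thesis
      by (rule real_tendsto_sandwich[rotated 3, where f = "\<lambda>_. 0"]) (simp_all add: upper d0[OF q'])
  qed
  have mean: "(\<Sum>q\<in>Q. \<pi> q * a n q) = c" if "n > 0" for n
  proof -
    have "(\<Sum>q\<in>Q. \<pi> q * a n q) = (1 / real n) * (\<Sum>i<n. \<Sum>q\<in>Q. \<pi> q * f i q)"
      by (simp add: a_def sum_distrib_left mult_ac) (subst sum.swap, simp add: mult_ac)
    then show ?thesis
      using that by (simp add: inv)
  qed
  \<comment> \<open>The vanishing defects show only that the averages approach their maximum. The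
    conserved mean \<open>c\<close> determines that maximum: \<open>top n\<close> equals the first
    quotient.\<close>
  have lim: "(\<lambda>n. ((\<Sum>q\<in>Q. \<pi> q * d n q) + c) / (\<Sum>q\<in>Q. \<pi> q) - d n q)
      \<longlonglongrightarrow> ((\<Sum>q\<in>Q. \<pi> q * 0) + c) / (\<Sum>q\<in>Q. \<pi> q) - 0"
    using weight q by (intro tendsto_intros dto0) auto
  have eq: "((\<Sum>q\<in>Q. \<pi> q * d n q) + c) / (\<Sum>q\<in>Q. \<pi> q) - d n q = a n q" if "n > 0" for n
  proof -
    have "(\<Sum>q\<in>Q. \<pi> q * d n q) + c = (\<Sum>q\<in>Q. \<pi> q) * top n"
      using mean[OF that] by (simp add: d_def right_diff_distrib sum_subtractf sum_distrib_right)
    then show ?thesis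
      using weight by (simp add: d_def)
  qed
  have "(\<lambda>n. a n q) \<longlonglongrightarrow> ((\<Sum>q\<in>Q. \<pi> q * 0) + c) / (\<Sum>q\<in>Q. \<pi> q) - 0"
    by (rule Lim_transform_eventually[OF lim eventually_mono[OF eventually_gt_at_top[of 0] eq]])
  then show ?thesis
    by (simp add: cesaro_to_def a_def)
qed

section \<open>Word probabilities of a Markov shift\<close>

lemma factor_conv_map: "factor x i j = map (\<lambda>k. x (i + int k)) [0..<nat (j - i)]"
  by (rule nth_equalityI) (auto simp: factor_def)

lemma length_factor [simp]: "length (factor x i j) = nat (j - i)"
  by (simp add: factor_def)

lemma factor_append:
  assumes "i \<le> j" "j \<le> k"
  shows "factor x i k = factor x i j @ factor x j k"
  using assms upto_split1[of i j "k - 1"] by (cases "j = k") (simp_all add: factor_def)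

lemma factor_singleton [simp]: "factor x i (i + 1) = [x i]"
  by (simp add: factor_def)

lemma factor_0_1 [simp]: "factor x 0 1 = [x 0]"
  using factor_singleton[of x 0] by simp

lemma factor_empty [simp]: "factor x i i = []"
  by (simp add: factor_def)

lemma factor_shift_map: "factor (shift_map x) i j = factor x (i + 1) (j + 1)"
  by (auto simp: factor_conv_map shift_map_def add_ac)

lemma factor_snoc: "factor x 0 (int (Suc n)) = factor x 0 (int n) @ [x (int n)]"
  using factor_append[of 0 "int n" "int n + 1" x] by (simp add: add.commute[of 1])

lemma take_factor:
  assumes "i \<le> j" "j \<le> k"
  shows "take (nat (j - i)) (factor x i k) = factor x i j"
  using factor_append[OF assms, of x] by simp

lemma factor_Suc: "factor x 0 (int (Suc n)) = x 0 # factor (shift_map x) 0 (int n)"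
  using factor_append[of 0 1 "int (Suc n)" x] factor_singleton[of x 0]
  by (simp add: factor_shift_map add_ac)

lemma finite_words: "finite {w::'a::finite list. length w = n}"
  using finite_lists_length_eq[of "UNIV :: 'a set" n] by simp

text \<open>A basic open set constrains finitely many coordinates, so a centred window reaching
  beyond all of them decides membership.\<close>

lemma open_contains_cylinder:
  fixes x :: "int \<Rightarrow> 'b"
  assumes "openin (product_topology (\<lambda>_. discrete_topology UNIV) UNIV) U" "x \<in> U"
  shows "\<exists>k::nat. {y. factor y (- int k) (int k) = factor x (- int k) (int k)} \<subseteq> U"
proof -
  obtain V where V: "finite {n. V n \<noteq> (UNIV :: 'b set)}" "x \<in> Pi\<^sub>E UNIV V" "Pi\<^sub>E UNIV V \<subseteq> U"
    using assms by (auto simp: openin_product_topology_alt)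
  obtain k where k: "\<And>n. V n \<noteq> UNIV \<Longrightarrow> nat \<bar>n\<bar> < k"
    using finite_nat_set_iff_bounded[of "(\<lambda>n. nat \<bar>n\<bar>) ` {n. V n \<noteq> UNIV}"] V(1) by auto
  have "y \<in> U" if "factor y (- int k) (int k) = factor x (- int k) (int k)" for y
  proof -
    have "y n = x n" if "nat \<bar>n\<bar> < k" for n
    proof -
      have "n \<in> {- int k..int k - 1}"
        using that by auto
      then show ?thesis
        using \<open>factor y _ _ = _\<close> by (auto simp: factor_def)
    qed
    then have "y n \<in> V n" for n
      using k[of n] V(2) by (cases "V n = UNIV") (auto simp: PiE_UNIV_domain Pi_iff)
    then show ?thesis
      using V(3) by (auto simp: PiE_UNIV_domain Pi_iff)
  qed
  then show ?thesis
    by blast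
qed

locale markov_shift = prob_space \<mu>
  for \<mu> :: "(int \<Rightarrow> 'a::finite) measure" +
  fixes r :: nat
  assumes sets_eq: "sets \<mu> = sets full_shift"
    and shift_invariant: "invariant_under \<mu> shift_map"
    and markov: "markov_measure r \<mu>"
begin

definition P :: "'a list \<Rightarrow> real" where
  "P w = measure \<mu> {x. factor x 0 (int (length w)) = w}"

lemma space_eq [simp]: "space \<mu> = UNIV"
  using sets_eq_imp_space_eq[OF sets_eq] by (simp add: space_PiM PiE_UNIV_domain)

lemma measurable_factor: "(\<lambda>x. factor x i j) \<in> measurable \<mu> (count_space UNIV)"
proof -
  have coord: "{x. x n = a} \<in> sets \<mu>" for n a
  proof -
    have "(\<lambda>x. x n) -` {a} \<inter> space full_shift \<in> sets full_shift"
      by (rule measurable_sets[OF measurable_component_singleton]) auto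
    then show ?thesis
      by (simp add: sets_eq space_PiM PiE_UNIV_domain vimage_def)
  qed
  have "{x. map x ns = w} \<in> sets \<mu>" for ns and w :: "'a list"
  proof (induction ns arbitrary: w)
    case Nil
    show ?case
      using sets.top[of \<mu>] by (cases w) simp_all
  next
    case (Cons n ns)
    show ?case
    proof (cases w)
      case (Cons a v)
      have "{x. map x (n # ns) = a # v} = {x. x n = a} \<inter> {x. map x ns = v}"
        by auto
      then show ?thesis
        using coord Cons.IH Cons by auto
    qed simp
  qed
  then show ?thesis
    by (simp add: measurable_count_space_eq2_countable factor_def vimage_def)
qed

lemma sets_factor: "{x. R (factor x i j)} \<in> sets \<mu>"
  using measurable_sets[OF measurable_factor[of i j], of "Collect R"] by (simp add: vimage_def)

lemma sets_factor_eq [simp]: "{x. factor x i j = w} \<in> sets \<mu>"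
  by (rule sets_factor)

lemma sets_letter [simp]: "{x. x n = a} \<in> sets \<mu>"
  using sets_factor_eq[of n "n + 1" "[a]"] by simp

lemma measure_shift_map: "E \<in> sets \<mu> \<Longrightarrow> measure \<mu> {x. shift_map x \<in> E} = measure \<mu> E"
  using invariant_under_measure_vimage[OF shift_invariant, of E] by (simp add: vimage_def)

lemma measure_factor_translate:
  "measure \<mu> {x. R (factor x i (i + k))} = measure \<mu> {x. R (factor x 0 k)}"
proof -
  have step: "measure \<mu> {x. R (factor x (i + 1) (i + 1 + k))} = measure \<mu> {x. R (factor x i (i + k))}" for i
    using measure_shift_map[OF sets_factor[of R i "i + k"]] by (simp add: factor_shift_map add_ac)
  show ?thesis
  proof (induction i rule: int_induct[of _ 0])
    case (step2 i)
    then show ?case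
      using step[of "i - 1"] by simp
  qed (use step in auto)
qed

lemma measure_factor_eq: "measure \<mu> {x. factor x i (i + int (length w)) = w} = P w"
  using measure_factor_translate[of "\<lambda>v. v = w" i "int (length w)"] by (simp add: P_def)

lemma measure_factor_in:
  "measure \<mu> {x. factor x 0 (int n) \<in> W} = (\<Sum>w | length w = n \<and> w \<in> W. P w)"
proof -
  have "{x. factor x 0 (int n) \<in> W} = (\<Union>w\<in>{w. length w = n \<and> w \<in> W}. {x. factor x 0 (int n) = w})"
    by auto
  moreover have "finite {w. length w = n \<and> w \<in> W}"
    by (rule finite_subset[OF _ finite_words[of n]]) auto
  ultimately have "measure \<mu> {x. factor x 0 (int n) \<in> W}
      = (\<Sum>w | length w = n \<and> w \<in> W. measure \<mu> {x. factor x 0 (int n) = w})"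
    by (simp only:) (rule finite_measure_finite_Union; auto simp: disjoint_family_on_def)
  also have "\<dots> = (\<Sum>w | length w = n \<and> w \<in> W. P w)"
    by (rule sum.cong) (auto simp: P_def)
  finally show ?thesis .
qed

lemma P_nonneg: "0 \<le> P w"
  by (simp add: P_def)

lemma P_snoc: "P w = (\<Sum>a\<in>UNIV. P (w @ [a]))"
proof -
  have "factor x 0 (int (Suc (length w))) = factor x 0 (int (length w)) @ [x (int (length w))]" for x :: "int \<Rightarrow> 'a"
    using factor_append[of 0 "int (length w)" "int (Suc (length w))" x]
      factor_singleton[of x "int (length w)"] by (simp add: add_ac)
  then have "{x. factor x 0 (int (length w)) = w} = {x. factor x 0 (int (Suc (length w))) \<in> range (\<lambda>a. w @ [a])}"
    by auto
  then have "P w = (\<Sum>v | length v = Suc (length w) \<and> v \<in> range (\<lambda>a. w @ [a]). P v)"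
    unfolding P_def by (simp only: measure_factor_in P_def)
  also have "{v. length v = Suc (length w) \<and> v \<in> range (\<lambda>a. w @ [a])} = range (\<lambda>a. w @ [a])"
    by auto
  also have "(\<Sum>v\<in>range (\<lambda>a. w @ [a]). P v) = (\<Sum>a\<in>UNIV. P (w @ [a]))"
    by (subst sum.reindex) (auto simp: inj_def)
  finally show ?thesis .
qed

lemma P_append_le: "P (u @ v) \<le> P u" "P (u @ v) \<le> P v"
proof -
  have split: "factor x 0 (int (length (u @ v))) = factor x 0 (int (length u)) @
      factor x (int (length u)) (int (length u) + int (length v))" for x :: "int \<Rightarrow> 'a"
    using factor_append[of 0 "int (length u)" "int (length (u @ v))" x] by simp
  show "P (u @ v) \<le> P u"
    unfolding P_def split by (rule finite_measure_mono) auto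
  have "P (u @ v) \<le> measure \<mu> {x. factor x (int (length u)) (int (length u) + int (length v)) = v}"
    unfolding P_def split by (rule finite_measure_mono) auto
  then show "P (u @ v) \<le> P v"
    by (simp add: measure_factor_eq)
qed

lemma P_positive_append:
  assumes "0 < P (u @ v)"
  shows "0 < P u" "0 < P v"
  using assms P_append_le[of u v] by auto

lemma P_extend: "0 < P w \<Longrightarrow> \<exists>v. length v = n \<and> 0 < P (w @ v)"
proof (induction n)
  case 0
  then show ?case
    by auto
next
  case (Suc n)
  then obtain v where v: "length v = n" "0 < P (w @ v)"
    by auto
  then obtain a where "P (w @ v @ [a]) \<noteq> 0"
    using P_snoc[of "w @ v"] by (metis append_assoc less_irrefl sum.neutral)
  then show ?case
    using v P_nonneg[of "w @ v @ [a]"] by (intro exI[of _ "v @ [a]"]) auto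
qed

text \<open>The Markov condition as an identity between quotients of word probabilities; invariance
  moves the window of the last \<open>r\<close> letters to position 0.\<close>

lemma P_markov_snoc:
  assumes "r \<le> length w" "P w \<noteq> 0"
  shows "P (w @ [a]) / P w = P (drop (length w - r) w @ [a]) / P (drop (length w - r) w)"
proof -
  define m where "m = length w"
  define s where "s = drop (m - r) w"
  have len: "length s = r"
    using assms by (simp add: s_def m_def)
  have "factor x 0 (int m + 1) = factor x 0 (int m) @ [x (int m)]" for x :: "int \<Rightarrow> 'a"
    using factor_append[of 0 "int m" "int m + 1" x] by simp
  then have 1: "{x. x (int m) = a \<and> factor x 0 (int m) = w} = {x. factor x 0 (int (length (w @ [a]))) = w @ [a]}"
    by (auto simp: m_def add_ac)
  have "factor x (int m - int r) (int m + 1) = factor x (int m - int r) (int m) @ [x (int m)]" for x :: "int \<Rightarrow> 'a"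
    using factor_append[of "int m - int r" "int m" "int m + 1" x] by simp
  then have 2: "{x. x (int m) = a \<and> factor x (int m - int r) (int m) = s}
      = {x. factor x (int m - int r) (int m - int r + int (length (s @ [a]))) = s @ [a]}"
    by (auto simp: len add_ac)
  have 3: "{x. factor x (int m - int r) (int m) = s}
      = {x. factor x (int m - int r) (int m - int r + int (length s)) = s}"
    by (simp add: len)
  have "\<P>(x in \<mu>. x (int m) = a \<bar> factor x 0 (int m) = w) =
        \<P>(x in \<mu>. x (int m) = a \<bar> factor x (int m - int r) (int m) = s)"
    using markov assms unfolding markov_measure_def by (auto simp: m_def s_def P_def)
  then show ?thesis
    unfolding cond_prob_def
    by (simp add: 1 2 3 measure_factor_eq del: length_append) (simp add: P_def m_def s_def)
qed

text \<open>Conditional independence of past \<open>y\<close> and future \<open>v\<close> given a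
  block of at least \<open>r\<close> letters, in product form so that null words are covered. The
  words \<open>s @ v\<close> and \<open>y @ s @ v\<close> end in the same \<open>r\<close> letters,
  so appending a letter multiplies both probabilities by the same factor.\<close>

lemma P_markov:
  assumes s: "r \<le> length s"
  shows "P (y @ s @ v) * P s = P (y @ s) * P (s @ v)"
proof (induction v rule: rev_induct)
  case Nil
  show ?case
    by simp
next
  case (snoc a v)
  show ?case
  proof (cases "P (y @ s @ v) = 0")
    case True
    then have "P (y @ s @ v @ [a]) = 0"
      using P_append_le(1)[of "y @ s @ v" "[a]"] P_nonneg[of "y @ s @ v @ [a]"] by simp
    moreover have "P (y @ s) = 0 \<or> P (s @ v @ [a]) = 0"
      using snoc True P_append_le(1)[of "s @ v" "[a]"] P_nonneg[of "s @ v @ [a]"] by auto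
    ultimately show ?thesis
      by auto
  next
    case False
    define t where "t = drop (length (s @ v) - r) (s @ v)"
    have t': "drop (length (y @ s @ v) - r) (y @ s @ v) = t"
      using s by (simp add: t_def)
    have F: "P (s @ v) \<noteq> 0"
      using False P_append_le(2)[of y "s @ v"] P_nonneg[of "y @ s @ v"] by auto
    have 1: "P (y @ s @ v @ [a]) = P (y @ s @ v) * (P (t @ [a]) / P t)"
      using P_markov_snoc[of "y @ s @ v" a] s False unfolding t' by (simp add: field_simps)
    have 2: "P (s @ v @ [a]) = P (s @ v) * (P (t @ [a]) / P t)"
      using P_markov_snoc[of "s @ v" a] s F unfolding t_def[symmetric] by (simp add: field_simps)
    show ?thesis
      unfolding 1 2 using snoc by simp
  qed
qed

text \<open>Words of positive probability that overlap in at least \<open>r\<close> letters can be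
  glued; this is how the Markov property enters the irreducibility argument.\<close>

lemma P_glue:
  assumes "r \<le> length s" "0 < P (y @ s)" "0 < P (s @ v)"
  shows "0 < P (y @ s @ v)"
proof -
  have "P (y @ s @ v) * P s \<noteq> 0"
    unfolding P_markov[OF assms(1)] using assms(2,3) by simp
  then show ?thesis
    using P_nonneg[of "y @ s @ v"] by (simp add: less_le)
qed

section \<open>The topological support and its language\<close>

lemma measure_support_eq: "measure_support \<mu> = {x. \<forall>i j. 0 < P (factor x i j)}"
proof (intro equalityI subsetI CollectI allI)
  fix x i j
  assume x: "x \<in> measure_support \<mu>"
  let ?U = "{y. \<forall>n\<in>{i..j - 1}. y n = x n}"
  have U: "?U = {y. factor y i (i + int (length (factor x i j))) = factor x i j}"
    by (auto simp: factor_def)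
  have "openin (product_topology (\<lambda>_. discrete_topology UNIV) UNIV) ?U"
  proof -
    have "?U = (\<Pi>\<^sub>E n\<in>UNIV. if n \<in> {i..j - 1} then {x n} else UNIV)"
      by (auto simp: PiE_UNIV_domain Pi_iff split: if_splits)
    moreover have "finite {n. (if n \<in> {i..j - 1} then {x n} else UNIV) \<noteq> UNIV}"
      by (rule finite_subset[of _ "{i..j - 1}"]) auto
    ultimately show ?thesis
      by (auto simp: openin_PiE_gen)
  qed
  then have "0 < emeasure \<mu> ?U"
    using x by (auto simp: measure_support_def)
  then show "0 < P (factor x i j)"
    unfolding U emeasure_eq_measure measure_factor_eq by simp
next
  fix x
  assume x: "x \<in> {x. \<forall>i j. 0 < P (factor x i j)}"
  have "0 < emeasure \<mu> U" if U: "openin (product_topology (\<lambda>_. discrete_topology UNIV) UNIV) U" "x \<in> U" for U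
  proof -
    let ?cyl = "\<lambda>k w. {y. factor y (- int k) (int k) = w}"
    \<comment> \<open>Measurability of an open \<open>U\<close>: the k-th set depends on
      \<open>y\<close> only through its factor on a finite window.\<close>
    have "U = (\<Union>k. {y. ?cyl k (factor y (- int k) (int k)) \<subseteq> U})"
      using open_contains_cylinder[OF U(1)] by blast
    also have "\<dots> \<in> sets \<mu>"
      by (intro sets.countable_UN image_subsetI sets_factor)
    finally have "U \<in> sets \<mu>" .
    moreover obtain k where "?cyl k (factor x (- int k) (int k)) \<subseteq> U"
      using open_contains_cylinder[OF U] by blast
    ultimately have "measure \<mu> (?cyl k (factor x (- int k) (int k))) \<le> measure \<mu> U"
      by (intro finite_measure_mono)
    moreover have "0 < measure \<mu> (?cyl k (factor x (- int k) (int k)))"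
      using x measure_factor_eq[of "- int k" "factor x (- int k) (int k)"] by simp
    ultimately show ?thesis
      by (simp add: emeasure_eq_measure)
  qed
  then show "x \<in> measure_support \<mu>"
    by (auto simp: measure_support_def)
qed

lemma sets_measure_support: "measure_support \<mu> \<in> sets \<mu>"
proof -
  have "measure_support \<mu> = (\<Inter>i. \<Inter>j. {x. 0 < P (factor x i j)})"
    by (auto simp: measure_support_eq)
  also have "\<dots> \<in> sets \<mu>"
    by (intro sets.countable_INT image_subsetI sets_factor) auto
  finally show ?thesis .
qed

text \<open>There are countably many windows and words, so the complement of the support is a
  countable union of null cylinders.\<close>

lemma AE_in_measure_support: "AE x in \<mu>. x \<in> measure_support \<mu>"
proof -
  have "AE x in \<mu>. 0 < P (factor x i j)" for i j
  proof -
    have "\<forall>w\<in>{w. P w = 0}. AE x in \<mu>. factor x i (i + int (length w)) \<noteq> w"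
      by (auto simp: AE_iff_measurable[OF sets_factor_eq] emeasure_eq_measure measure_factor_eq)
    then have "AE x in \<mu>. \<forall>w\<in>{w. P w = 0}. factor x i (i + int (length w)) \<noteq> w"
      by (subst AE_ball_countable) auto
    then show ?thesis
    proof (rule AE_mp, intro AE_I2 impI)
      fix x assume *: "\<forall>w\<in>{w. P w = 0}. factor x i (i + int (length w)) \<noteq> w"
      have "factor x i (i + int (length (factor x i j))) = factor x i j"
        by (simp add: factor_conv_map)
      then show "0 < P (factor x i j)"
        using * P_nonneg[of "factor x i j"] by (auto simp: less_le)
    qed
  qed
  then show ?thesis
    by (simp add: measure_support_eq AE_all_countable)
qed

lemma measure_Int_support:
  "E \<in> sets \<mu> \<Longrightarrow> measure \<mu> {x \<in> measure_support \<mu>. x \<in> E} = measure \<mu> E"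
  unfolding Collect_conj_eq Collect_mem_eq using AE_in_measure_support sets_measure_support
  by (intro measure_eq_AE) auto

lemma shift_map_in_support_iff: "shift_map x \<in> measure_support \<mu> \<longleftrightarrow> x \<in> measure_support \<mu>"
proof -
  have "(\<forall>i j. 0 < P (factor x (i + 1) (j + 1))) \<longleftrightarrow> (\<forall>i j. 0 < P (factor x i j))"
    by (metis diff_add_cancel)
  then show ?thesis
    by (simp add: measure_support_eq factor_shift_map)
qed

text \<open>The support has full measure, so it meets every cylinder of positive measure.\<close>

lemma language_support: "language (measure_support \<mu>) = {w. 0 < P w}"
proof (intro equalityI subsetI)
  fix w assume "w \<in> {w. 0 < P w}"
  then have "0 < measure \<mu> {x \<in> measure_support \<mu>. x \<in> {x. factor x 0 (int (length w)) = w}}"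
    by (subst measure_Int_support) (auto simp: P_def)
  then obtain x where "x \<in> measure_support \<mu>" "factor x 0 (int (length w)) = w"
    by (metis (mono_tags, lifting) Collect_empty_eq less_irrefl measure_empty mem_Collect_eq)
  then show "w \<in> language (measure_support \<mu>)"
    unfolding language_def by (metis (mono_tags, lifting) mem_Collect_eq of_nat_0_le_iff)
qed (auto simp: language_def measure_support_eq)

end

section \<open>The skew product\<close>

locale markov_skew_product = markov_shift \<mu> r + group G
  for \<mu> :: "(int \<Rightarrow> 'a::finite) measure" and r :: nat and G :: "('g, 'b) monoid_scheme" (structure) +
  fixes \<phi> :: "'a list \<Rightarrow> 'g"
  assumes letters: "\<forall>a. \<exists>x\<in>measure_support \<mu>. \<exists>n. x n = a"
    and fin: "finite (carrier G)"
    and epi: "\<phi> \<in> epi word_monoid G" and phi_Nil [simp]: "\<phi> [] = \<one>"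
    and irreducible: "morphism_irreducible G \<phi> (measure_support \<mu>)"
begin

abbreviation S :: "(int \<Rightarrow> 'a) set" where "S \<equiv> measure_support \<mu>"
abbreviation M :: "('g \<times> (int \<Rightarrow> 'a)) measure" where "M \<equiv> skew_measure G \<mu>"
abbreviation T :: "'g \<times> (int \<Rightarrow> 'a) \<Rightarrow> 'g \<times> (int \<Rightarrow> 'a)" where "T \<equiv> skew_map G \<phi>"
abbreviation N :: real where "N \<equiv> real (card (carrier G))"

section \<open>The morphism and words with a prescribed group value\<close>

lemma phi_closed [simp]: "\<phi> w \<in> carrier G"
  using epi by (auto simp: epi_def hom_def word_monoid_def)

lemma phi_append: "\<phi> (u @ v) = \<phi> u \<otimes> \<phi> v"
  using epi by (auto simp: epi_def hom_def word_monoid_def)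

lemma phi_Cons: "\<phi> (a # v) = \<phi> [a] \<otimes> \<phi> v"
  using phi_append[of "[a]" v] by simp

lemma phi_surj: "k \<in> carrier G \<Longrightarrow> \<exists>z. \<phi> z = k"
  using epi by (force simp: epi_def word_monoid_def)

lemma N_pos: "0 < N"
  using fin one_closed by (auto simp: card_gt_0_iff)

lemma P_letter: "0 < P [a]"
proof -
  obtain x n where "x \<in> S" "x n = a"
    using letters by blast
  then show ?thesis
    using factor_singleton[of x n] unfolding measure_support_eq by (metis (lifting) mem_Collect_eq)
qed

lemma irreducible_one:
  assumes "0 < P u" "0 < P v"
  shows "\<exists>w. 0 < P (u @ w @ v) \<and> \<phi> (u @ w) = \<one>"
  using irreducible assms by (simp add: morphism_irreducible_def language_support)

text \<open>Irreducibility only controls the value \<open>\<one>\<close>. Applied to the last \<open>r\<close> letters of a word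
  it leaves the image of the remaining prefix unchanged, and the Markov property lets us glue;
  so each letter can be appended to the image.\<close>

lemma irreducible_all_values:
  assumes "0 < P s" "0 < P t" "k \<in> carrier G"
  shows "\<exists>w. 0 < P (s @ w @ t) \<and> \<phi> (s @ w) = k"
proof -
  have "\<exists>w. 0 < P (s @ w @ t) \<and> \<phi> (s @ w) = \<phi> z" if "0 < P t" for z t
    using that
  proof (induction z arbitrary: t rule: rev_induct)
    case Nil
    then show ?case
      using irreducible_one[OF assms(1)] by simp
  next
    case (snoc a z)
    \<comment> \<open>The block \<open>u\<close> of \<open>r\<close> letters is where the gluing
      happens: the induction hypothesis is applied with target \<open>[a] @ u\<close> in place of
      \<open>t\<close>, and irreducibility then leads from \<open>u\<close> to \<open>t\<close> with
      trivial group value.\<close>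
    obtain u where u: "length u = r" "0 < P ([a] @ u)"
      using P_extend[OF P_letter] by blast
    obtain w where w: "0 < P (s @ w @ [a] @ u)" "\<phi> (s @ w) = \<phi> z"
      using snoc.IH[OF u(2)] by blast
    obtain w' where w': "0 < P (u @ w' @ t)" "\<phi> (u @ w') = \<one>"
      using irreducible_one[OF P_positive_append(2)[OF u(2)] snoc.prems] by blast
    have "0 < P ((s @ w @ [a]) @ u @ w' @ t)"
      using u w w' by (intro P_glue[of u]) auto
    moreover have "\<phi> ((s @ w) @ [a] @ u @ w') = \<phi> (z @ [a])"
      by (simp only: phi_append[of "s @ w"] phi_append[of "[a]"] phi_append[of z] w(2) w'(2) r_one phi_closed)
    ultimately show ?case
      by (intro exI[of _ "w @ [a] @ u @ w'"]) simp
  qed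
  then show ?thesis
    using assms phi_surj by blast
qed

section \<open>The product measure and its invariance\<close>

lemma space_M: "space M = carrier G \<times> S"
  by (simp add: skew_measure_def space_pair_measure space_uniform_count_measure space_restrict_space)

lemma prob_space_support: "prob_space (restrict_space \<mu> S)"
  using AE_in_measure_support sets_measure_support
  by (intro prob_space_restrict_space) (simp_all add: emeasure_eq_1_AE)

lemma prob_space_M: "prob_space M"
proof -
  interpret R: prob_space "restrict_space \<mu> S"
    by (rule prob_space_support)
  interpret U: prob_space "uniform_count_measure (carrier G)"
    using fin by (intro prob_space_uniform_count_measure) auto
  interpret pair_prob_space "uniform_count_measure (carrier G)" "restrict_space \<mu> S" ..
  show ?thesis
    unfolding skew_measure_def by (rule prob_space_axioms)
qed

sublocale M: prob_space M
  by (rule prob_space_M)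

lemma sets_Times_M: "A \<subseteq> carrier G \<Longrightarrow> B \<in> sets \<mu> \<Longrightarrow> B \<subseteq> S \<Longrightarrow> A \<times> B \<in> sets M"
  unfolding skew_measure_def using sets_measure_support
  by (intro pair_measureI) (auto simp: sets_uniform_count_measure sets_restrict_space_iff)

lemma sets_support_Collect: "{x. R x} \<in> sets \<mu> \<Longrightarrow> {x \<in> S. R x} \<in> sets \<mu>"
  using sets_measure_support by (simp add: Collect_conj_eq)

lemma sets_slice:
  assumes "E \<in> sets M"
  shows "{x \<in> S. (g, x) \<in> E} \<in> sets \<mu>"
proof -
  have "Pair g -` E \<in> sets (restrict_space \<mu> S)"
    using assms unfolding skew_measure_def by (rule sets_Pair1)
  moreover have "Pair g -` E = {x \<in> S. (g, x) \<in> E}"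
    using sets.sets_into_space[OF assms] by (auto simp: space_M)
  ultimately show ?thesis
    using sets_measure_support by (simp add: sets_restrict_space_iff)
qed

lemma measure_M:
  assumes E: "E \<in> sets M"
  shows "measure M E = (\<Sum>g\<in>carrier G. measure \<mu> {x \<in> S. (g, x) \<in> E}) / N"
proof -
  interpret R: prob_space "restrict_space \<mu> S"
    by (rule prob_space_support)
  have slice: "Pair g -` E = {x \<in> S. (g, x) \<in> E}" for g
    using sets.sets_into_space[OF E] by (auto simp: space_M)
  have "emeasure M E = (\<Sum>g\<in>carrier G. ennreal (1 / N) * emeasure (restrict_space \<mu> S) {x \<in> S. (g, x) \<in> E})"
    using E fin unfolding skew_measure_def
    by (simp add: R.emeasure_pair_measure_alt uniform_count_measure_def slice nn_integral_point_measure_finite)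
  also have "\<dots> = (\<Sum>g\<in>carrier G. ennreal (measure \<mu> {x \<in> S. (g, x) \<in> E} / N))"
    using sets_measure_support
    by (intro sum.cong) (auto simp: emeasure_restrict_space emeasure_eq_measure simp flip: ennreal_mult)
  also have "\<dots> = ennreal ((\<Sum>g\<in>carrier G. measure \<mu> {x \<in> S. (g, x) \<in> E}) / N)"
    by (subst sum_ennreal) (auto simp: sum_divide_distrib)
  finally show ?thesis
    by (simp add: measure_def[of M] sum_nonneg)
qed

lemma measure_M_Times:
  assumes "A \<subseteq> carrier G" "B \<in> sets \<mu>" "B \<subseteq> S"
  shows "measure M (A \<times> B) = real (card A) * measure \<mu> B / N"
proof -
  have "(\<Sum>g\<in>carrier G. measure \<mu> {x \<in> S. (g, x) \<in> A \<times> B}) = (\<Sum>g\<in>carrier G. if g \<in> A then measure \<mu> B else 0)"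
    using assms(3) by (intro sum.cong refl) (auto intro!: arg_cong[where f = "measure \<mu>"])
  also have "\<dots> = real (card A) * measure \<mu> B"
    using assms(1) fin by (simp add: Int_absorb1 flip: sum.inter_restrict)
  finally show ?thesis
    using assms by (simp add: measure_M sets_Times_M)
qed

lemma measurable_T: "T \<in> measurable M M"
proof -
  have fst: "(\<lambda>z. fst z \<otimes> \<phi> [snd z 0]) \<in> measurable M (uniform_count_measure (carrier G))"
  proof -
    have "(\<lambda>z. fst z \<otimes> \<phi> [snd z 0]) -` {k} \<inter> space M \<in> sets M" for k
    proof -
      have "(\<lambda>z. fst z \<otimes> \<phi> [snd z 0]) -` {k} \<inter> space M
          = (\<Union>a. {g \<in> carrier G. g \<otimes> \<phi> [a] = k} \<times> {x \<in> S. factor x 0 1 = [a]})"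
        by (auto simp: space_M)
      also have "\<dots> \<in> sets M"
        by (intro sets.finite_UN sets_Times_M sets_support_Collect) auto
      finally show ?thesis .
    qed
    then have "(\<lambda>z. fst z \<otimes> \<phi> [snd z 0]) \<in> measurable M (count_space (carrier G))"
      using fin by (subst measurable_count_space_eq2) (auto simp: space_M)
    then show ?thesis
      by (simp add: measurable_cong_sets[OF refl sets_uniform_count_measure_count_space])
  qed
  have "snd \<in> measurable M (restrict_space \<mu> S)"
    unfolding skew_measure_def by (rule measurable_snd)
  then have "snd \<in> measurable M \<mu>"
    by (simp add: measurable_restrict_space2_iff)
  then have "(\<lambda>z. shift_map (snd z)) \<in> measurable M \<mu>"
    using shift_invariant by (auto simp: invariant_under_def)
  then have "(\<lambda>z. shift_map (snd z)) \<in> measurable M (restrict_space \<mu> S)"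
    by (intro measurable_restrict_space2) (auto simp: space_M shift_map_in_support_iff)
  then have "(\<lambda>z. (fst z \<otimes> \<phi> [snd z 0], shift_map (snd z))) \<in> measurable M M"
    using fst by (simp add: skew_measure_def[of G \<mu>])
  then show ?thesis
    by (simp add: skew_map_def case_prod_unfold)
qed

lemma measure_split_letter:
  assumes "A \<in> sets \<mu>"
  shows "measure \<mu> A = (\<Sum>a\<in>UNIV. measure \<mu> {x \<in> A. x 0 = a})"
proof -
  have "{x \<in> A. x 0 = a} \<in> sets \<mu>" for a
    unfolding Collect_conj_eq Collect_mem_eq using assms by (intro sets.Int sets_letter)
  moreover have "A = (\<Union>a. {x \<in> A. x 0 = a})"
    by auto
  ultimately show ?thesis
    using finite_measure_finite_Union[of UNIV "\<lambda>a. {x \<in> A. x 0 = a}"]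
    by (auto simp: disjoint_family_on_def)
qed

text \<open>Where \<open>x 0 = a\<close>, the group coordinate undergoes right multiplication by
  \<open>\<phi> [a]\<close>, a bijection of the group, so the sum over the group is unchanged.
  Summing the pieces over \<open>a\<close> again leaves the shift alone, which preserves
  \<open>\<mu>\<close>.\<close>

lemma invariant_T: "invariant_under M T"
proof -
  have "measure M (T -` E \<inter> space M) = measure M E" if E: "E \<in> sets M" for E
  proof -
    define F where "F g a = measure \<mu> {x \<in> S. x 0 = a \<and> (g, shift_map x) \<in> E}" for g a
    have "measure M (T -` E \<inter> space M)
        = (\<Sum>g\<in>carrier G. measure \<mu> {x \<in> S. (g, x) \<in> T -` E \<inter> space M}) / N"
      by (rule measure_M[OF measurable_sets[OF measurable_T E]])
    also have "(\<Sum>g\<in>carrier G. measure \<mu> {x \<in> S. (g, x) \<in> T -` E \<inter> space M})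
        = (\<Sum>g\<in>carrier G. \<Sum>a\<in>UNIV. F (g \<otimes> \<phi> [a]) a)"
      unfolding F_def
      by (subst measure_split_letter[OF sets_slice[OF measurable_sets[OF measurable_T E]]])
         (auto simp: space_M skew_map_def intro!: sum.cong arg_cong[where f = "measure \<mu>"])
    also have "\<dots> = (\<Sum>a\<in>UNIV. \<Sum>g\<in>carrier G. F g a)"
    proof (subst sum.swap, rule sum.cong[OF refl])
      fix a
      have "bij_betw (\<lambda>g. g \<otimes> \<phi> [a]) (carrier G) (carrier G)"
        by (rule bij_betw_byWitness[where f' = "\<lambda>g. g \<otimes> inv \<phi> [a]"]) (auto simp: m_assoc)
      then show "(\<Sum>g\<in>carrier G. F (g \<otimes> \<phi> [a]) a) = (\<Sum>g\<in>carrier G. F g a)"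
        by (rule sum.reindex_bij_betw)
    qed
    also have "\<dots> = (\<Sum>g\<in>carrier G. \<Sum>a\<in>UNIV. F g a)"
      by (rule sum.swap)
    also have "\<dots> = (\<Sum>g\<in>carrier G. measure \<mu> {x \<in> S. (g, x) \<in> E})"
    proof (rule sum.cong[OF refl])
      fix g
      let ?E = "{x \<in> S. (g, x) \<in> E}"
      have sh: "{x. shift_map x \<in> ?E} \<in> sets \<mu>"
        using shift_invariant measurable_sets[of shift_map \<mu> \<mu>, OF _ sets_slice[OF E, of g]]
        by (simp add: invariant_under_def vimage_def)
      have "measure \<mu> ?E = measure \<mu> {x. shift_map x \<in> ?E}"
        by (rule measure_shift_map[OF sets_slice[OF E], symmetric])
      also have "\<dots> = (\<Sum>a\<in>UNIV. F g a)"
        unfolding F_def measure_split_letter[OF sh]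
        by (auto simp: shift_map_in_support_iff intro!: sum.cong arg_cong[where f = "measure \<mu>"])
      finally show "(\<Sum>a\<in>UNIV. F g a) = measure \<mu> ?E" ..
    qed
    finally show ?thesis
      by (simp add: measure_M[OF E])
  qed
  then have "distr M M T = M"
    by (intro measure_eqI) (auto simp: emeasure_distr measurable_T M.emeasure_eq_measure)
  then show ?thesis
    using measurable_T by (simp add: invariant_under_def)
qed

section \<open>One-sided events and the finite Markov chain\<close>

definition fut :: "nat \<Rightarrow> ('g \<times> 'a list) set \<Rightarrow> ('g \<times> (int \<Rightarrow> 'a)) set" where
  "fut n W = {(g, x). g \<in> carrier G \<and> x \<in> S \<and> (g, factor x 0 (int n)) \<in> W}"

text \<open>Events that read the group coordinate and finitely many letters from position 0 on. The
  class is closed under preimages by \<open>T\<close>, at the cost of one more letter, and its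
  members are finite unions of chain states once the words are padded.\<close>

definition future :: "('g \<times> (int \<Rightarrow> 'a)) set \<Rightarrow> bool" where
  "future E \<longleftrightarrow> (\<exists>n W. E = fut n W)"

definition cyl :: "'g \<Rightarrow> 'a list \<Rightarrow> ('g \<times> (int \<Rightarrow> 'a)) set" where
  "cyl g u = {g} \<times> {x \<in> S. factor x 0 (int (length u)) = u}"

lemma future_ge:
  assumes "future E"
  shows "\<exists>n\<ge>k. \<exists>W. E = fut n W"
proof -
  obtain n W where E: "E = fut n W"
    using assms by (auto simp: future_def)
  have "fut n W = fut (n + k) {(g, w). (g, take n w) \<in> W}"
    using take_factor[of 0 "int n" "int (n + k)", where 'a = 'a] by (auto simp: fut_def)
  then show ?thesis
    using E by (intro exI[of _ "n + k"]) auto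
qed

lemma sets_cyl [simp]: "g \<in> carrier G \<Longrightarrow> cyl g u \<in> sets M"
  unfolding cyl_def by (intro sets_Times_M sets_support_Collect) auto

lemma sets_fut [simp]: "fut n W \<in> sets M"
proof -
  have "fut n W = (\<Union>z\<in>(carrier G \<times> {w. length w = n}) \<inter> W. cyl (fst z) (snd z))"
  proof (intro equalityI subsetI)
    fix z assume "z \<in> fut n W"
    then show "z \<in> (\<Union>z\<in>(carrier G \<times> {w. length w = n}) \<inter> W. cyl (fst z) (snd z))"
      by (intro UN_I[of "(fst z, factor (snd z) 0 (int n))"]) (auto simp: fut_def cyl_def)
  qed (auto simp: fut_def cyl_def)
  also have "\<dots> \<in> sets M"
    using fin finite_words[of n] by (intro sets.finite_UN) auto
  finally show ?thesis .
qed

lemma sets_future: "future E \<Longrightarrow> E \<in> sets M"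
  by (auto simp: future_def)

lemma vimage_fut: "T -` fut n W \<inter> space M = fut (Suc n) {(g, v). v \<noteq> [] \<and> (g \<otimes> \<phi> [hd v], tl v) \<in> W}"
  by (auto simp: fut_def space_M skew_map_def shift_map_in_support_iff factor_Suc simp del: of_nat_Suc)

lemma future_vimage: "future E \<Longrightarrow> future (T -` E \<inter> space M)"
proof -
  assume "future E"
  then obtain n W where "E = fut n W"
    by (auto simp: future_def)
  then show ?thesis
    unfolding future_def using vimage_fut[of n W] by blast
qed

lemma vimage_Suc: "(T ^^ Suc n) -` E \<inter> space M = T -` ((T ^^ n) -` E \<inter> space M) \<inter> space M"
  using measurable_space[OF measurable_T] by (auto simp del: funpow.simps simp: funpow_Suc_right comp_def)

lemma future_vimage_funpow: "future E \<Longrightarrow> future ((T ^^ n) -` E \<inter> space M)"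
proof (induction n)
  case 0
  then show ?case
    using sets.sets_into_space[OF sets_future[OF 0]] by (simp add: Int_absorb2)
next
  case (Suc n)
  then show ?case
    unfolding vimage_Suc by (intro future_vimage)
qed

lemma measure_factor_in_M:
  assumes "g \<in> carrier G"
  shows "measure M ({g} \<times> {x \<in> S. factor x 0 (int n) \<in> V}) = (\<Sum>w | length w = n \<and> w \<in> V. P w) / N"
  using measure_M_Times[of "{g}" "{x \<in> S. factor x 0 (int n) \<in> V}"] assms
    measure_Int_support[OF sets_factor[of "\<lambda>w. w \<in> V" 0 "int n"]]
    sets_support_Collect[OF sets_factor[of "\<lambda>w. w \<in> V" 0 "int n"]]
  by (auto simp: measure_factor_in)

lemma measure_cyl: "g \<in> carrier G \<Longrightarrow> measure M (cyl g u) = P u / N"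
proof -
  have "{w. length w = length u \<and> w \<in> {u}} = {u}"
    by auto
  then show "g \<in> carrier G \<Longrightarrow> measure M (cyl g u) = P u / N"
    using measure_factor_in_M[of g "length u" "{u}"] by (simp add: cyl_def)
qed

text \<open>The Markov property of the skew product: given \<open>a # t\<close>, what happens after
  one step depends only on the new state. It reduces to \<open>P_markov\<close> with past
  \<open>[a]\<close> and block \<open>t\<close>, applied to each word that starts with
  \<open>t\<close>.\<close>

lemma measure_cyl_markov:
  assumes g: "g \<in> carrier G" and t: "r \<le> length t" and E: "future E"
  shows "P t * measure M (cyl g (a # t) \<inter> T -` E) = P (a # t) * measure M (cyl (g \<otimes> \<phi> [a]) t \<inter> E)"
proof -
  obtain n W where n: "length t \<le> n" and E: "E = fut n W"
    using future_ge[OF E, of "length t"] by auto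
  define V where "V = {w. length w = n \<and> take (length t) w = t \<and> (g \<otimes> \<phi> [a], w) \<in> W}"
  have take: "factor x 0 (int (length t)) = take (length t) (factor x 0 (int n))" for x :: "int \<Rightarrow> 'a"
    using take_factor[of 0 "int (length t)" "int n" x] n by simp
  have V: "{w. length w = n \<and> w \<in> V} = V"
    by (auto simp: V_def)
  have "cyl (g \<otimes> \<phi> [a]) t \<inter> E = {g \<otimes> \<phi> [a]} \<times> {x \<in> S. factor x 0 (int n) \<in> V}"
    using g by (auto simp: cyl_def E fut_def V_def take)
  then have 1: "measure M (cyl (g \<otimes> \<phi> [a]) t \<inter> E) = (\<Sum>w\<in>V. P w) / N"
    using measure_factor_in_M[of "g \<otimes> \<phi> [a]" n V] g by (simp add: V)
  have "cyl g (a # t) \<inter> T -` E = {g} \<times> {x \<in> S. factor x 0 (int (Suc n)) \<in> (#) a ` V}"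
    using g by (auto simp: cyl_def E fut_def V_def skew_map_def shift_map_in_support_iff factor_Suc take simp del: of_nat_Suc)
  moreover have "{w. length w = Suc n \<and> w \<in> (#) a ` V} = (#) a ` V"
    by (auto simp: V_def)
  ultimately have 2: "measure M (cyl g (a # t) \<inter> T -` E) = (\<Sum>w\<in>V. P (a # w)) / N"
    using measure_factor_in_M[OF g, of "Suc n" "(#) a ` V"] by (simp add: sum.reindex)
  have "P t * P (a # w) = P (a # t) * P w" if "w \<in> V" for w
    using that P_markov[OF t, of "[a]" "drop (length t) w"] append_take_drop_id[of "length t" w]
    by (simp add: V_def mult.commute)
  then show ?thesis
    unfolding 1 2 by (simp add: sum_distrib_left)
qed

lemma measure_partition_cyl:
  assumes E: "E \<in> sets M"
  shows "measure M E = (\<Sum>(g, s)\<in>carrier G \<times> {s. length s = n}. measure M (cyl g s \<inter> E))"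
proof -
  have "E = (\<Union>(g, s)\<in>carrier G \<times> {s. length s = n}. cyl g s \<inter> E)"
    using sets.sets_into_space[OF E] by (auto simp: cyl_def space_M)
  also have "measure M \<dots> = (\<Sum>(g, s)\<in>carrier G \<times> {s. length s = n}. measure M (cyl g s \<inter> E))"
    unfolding case_prod_unfold using fin finite_words[of n] E
    by (intro M.finite_measure_finite_Union) (auto simp: disjoint_family_on_def, auto simp: cyl_def)
  finally show ?thesis .
qed

text \<open>Measurability is asked of the intersection because \<open>E\<close> will be a preimage
  under \<open>T\<close> that is not cut down to \<open>space M\<close>.\<close>

lemma measure_cyl_snoc:
  assumes g: "g \<in> carrier G" and E: "cyl g s \<inter> E \<in> sets M"
  shows "measure M (cyl g s \<inter> E) = (\<Sum>b\<in>UNIV. measure M (cyl g (s @ [b]) \<inter> E))"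
proof -
  have c: "cyl g (s @ [b]) = {(g', x) \<in> cyl g s. x (int (length s)) = b}" for b
    by (auto simp: cyl_def factor_snoc simp del: of_nat_Suc)
  have "cyl g s \<inter> E = (\<Union>b. cyl g (s @ [b]) \<inter> E)"
    by (auto simp: c)
  moreover have "cyl g (s @ [b]) \<inter> E \<in> sets M" for b
  proof -
    have "cyl g (s @ [b]) \<inter> E = cyl g (s @ [b]) \<inter> (cyl g s \<inter> E)"
      by (auto simp: c)
    then show ?thesis
      using g E by (metis sets.Int sets_cyl)
  qed
  ultimately show ?thesis
    using M.finite_measure_finite_Union[of UNIV "\<lambda>b. cyl g (s @ [b]) \<inter> E"]
    by (auto simp: disjoint_family_on_def c)
qed

text \<open>The maximum principle applied to \<open>f n (g, s)\<close>, which is 1/N times the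
  conditional probability of T^-n D given the state. The stationary weights \<open>P s\<close> have
  total mass N, so the limit m(D)/N times \<open>P u\<close> is the product of the two
  measures.\<close>

lemma cesaro_cyl_future:
  assumes g: "g \<in> carrier G" and u: "r \<le> length u" "u \<noteq> []" and D: "future D"
  shows "cesaro_to (\<lambda>n. measure M (cyl g u \<inter> (T ^^ n) -` D)) (measure M (cyl g u) * measure M D)"
proof (cases "P u = 0")
  case True
  have "measure M (cyl g u \<inter> (T ^^ n) -` D) = 0" for n
  proof -
    have "measure M (cyl g u \<inter> (T ^^ n) -` D) \<le> measure M (cyl g u)"
      using g by (intro M.finite_measure_mono) auto
    then show ?thesis
      using True measure_nonneg[of M "cyl g u \<inter> (T ^^ n) -` D"] by (simp add: measure_cyl[OF g])
  qed
  then show ?thesis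
    using True by (simp add: cesaro_to_const measure_cyl[OF g])
next
  case False
  define R where "R = length u"
  define pre where "pre n = (T ^^ n) -` D \<inter> space M" for n
  \<comment> \<open>Null words are left out: they have no transition probabilities, and
    irreducibility says nothing about them.\<close>
  define Q where "Q = {(g, s). g \<in> carrier G \<and> length s = R \<and> 0 < P s}"
  define p where "p = (\<lambda>(g :: 'g, s) b. P (s @ [b]) / P s)"
  define \<delta> where "\<delta> = (\<lambda>(g, s) b. (g \<otimes> \<phi> [hd s], tl s @ [b]))"
  define f where "f n = (\<lambda>(g, s). measure M (cyl g s \<inter> pre n) / P s)" for n
  have R: "r \<le> R" "0 < R"
    using u by (simp_all add: R_def)
  have pre: "future (pre n)" "pre n \<in> sets M" for n
    using future_vimage_funpow[OF D] sets_future by (auto simp: pre_def)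
  have pre_Suc: "pre (Suc n) = T -` pre n \<inter> space M" for n
    unfolding pre_def by (rule vimage_Suc)
  have cyl_space: "cyl g s \<subseteq> space M" if "g \<in> carrier G" for g s
    using that by (auto simp: cyl_def space_M)
  have finQ: "finite Q"
    by (rule finite_subset[OF _ finite_cartesian_product[OF fin finite_words[of R]]]) (auto simp: Q_def)
  have sum_Q: "(\<Sum>(g, s)\<in>Q. measure M (cyl g s \<inter> E)) = measure M E" if E: "E \<in> sets M" for E
  proof -
    have "(\<Sum>(g, s)\<in>Q. measure M (cyl g s \<inter> E))
        = (\<Sum>(g, s)\<in>carrier G \<times> {s. length s = R}. measure M (cyl g s \<inter> E))"
    proof (rule sum.mono_neutral_left)
      show "\<forall>z\<in>carrier G \<times> {s. length s = R} - Q. (case z of (g, s) \<Rightarrow> measure M (cyl g s \<inter> E)) = 0"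
      proof clarify
        fix g s assume "g \<in> carrier G" "(g, s) \<notin> Q" "R = length s"
        then have g: "g \<in> carrier G" and "P s = 0"
          using P_nonneg[of s] by (auto simp: Q_def less_le)
        then have "measure M (cyl g s) = 0"
          by (simp add: measure_cyl)
        then show "measure M (cyl g s \<inter> E) = 0"
          using M.finite_measure_mono[of "cyl g s \<inter> E" "cyl g s"] g
          by (simp add: measure_le_0_iff)
      qed
    qed (auto simp: fin finite_words Q_def)
    then show ?thesis
      using measure_partition_cyl[OF E, of R] by simp
  qed
  \<comment> \<open>The word probabilities sum to 1 over each of the N group elements.\<close>
  have weight: "(\<Sum>q\<in>Q. P (snd q)) = N"
  proof -
    have "(\<Sum>q\<in>Q. P (snd q)) = (\<Sum>q\<in>Q. N * (case q of (g, s) \<Rightarrow> measure M (cyl g s \<inter> space M)))"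
      using N_pos cyl_space by (intro sum.cong) (auto simp: Q_def measure_cyl Int_absorb2)
    also have "\<dots> = N"
      using sum_Q[of "space M"] M.prob_space by (simp flip: sum_distrib_left)
    finally show ?thesis .
  qed
  have "cesaro_to (\<lambda>n. f n (g, u)) (measure M D / (\<Sum>q\<in>Q. P (snd q)))"
  proof (rule cesaro_to_irreducible_chain[OF finQ, where p = p and \<delta> = \<delta>])
    show "0 \<le> p q b" for q b
      by (cases q) (simp add: p_def P_nonneg)
  next
    show "(\<Sum>b\<in>UNIV. p q b) = 1" if "q \<in> Q" for q
      using that by (auto simp: p_def Q_def P_snoc[symmetric] simp flip: sum_divide_distrib)
  next
    show "\<delta> q b \<in> Q" if "q \<in> Q" "0 < p q b" for q b
    proof -
      obtain g s where q: "q = (g, s)" "g \<in> carrier G" "length s = R" "0 < P s"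
        using \<open>q \<in> Q\<close> by (auto simp: Q_def)
      then have "0 < P (s @ [b])"
        using that(2) by (simp add: p_def zero_less_divide_iff)
      moreover have "s @ [b] = [hd s] @ tl s @ [b]"
        using q(3) R by (cases s) auto
      ultimately have "0 < P (tl s @ [b])"
        using P_positive_append(2) by metis
      then show ?thesis
        using q R by (auto simp: \<delta>_def Q_def)
    qed
  next
    let ?rel = "{(q, \<delta> q b) | q b. q \<in> Q \<and> 0 < p q b}"
    \<comment> \<open>A window of length \<open>R\<close> slides along \<open>y @ t\<close>. Every
      letter of \<open>y\<close> that leaves it is multiplied into the group coordinate, and at the
      end the window shows \<open>t\<close>.\<close>
    have path: "((g, take R (y @ t)), (g \<otimes> \<phi> y, t)) \<in> ?rel\<^sup>*"
      if "g \<in> carrier G" "length t = R" "0 < P (y @ t)" for g y t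
      using that
    proof (induction y arbitrary: g)
      case Nil
      then show ?case
        by simp
    next
      case (Cons a y)
      \<comment> \<open>\<open>?b\<close> is the letter that enters the window: index
        \<open>R\<close> of \<open>a # y @ t\<close>, hence \<open>R - 1\<close> of
        \<open>y @ t\<close>.\<close>
      let ?z = "y @ t" and ?s = "take R (a # y @ t)" and ?b = "(y @ t) ! (R - 1)"
      have s: "?s = a # take (R - 1) ?z"
        using R by (simp add: take_Cons')
      have z: "take (R - 1) ?z @ [?b] = take R ?z"
        using R Cons.prems(2) take_Suc_conv_app_nth[of "R - 1" ?z] by simp
      have sb: "?s @ [?b] = take (Suc R) (a # y @ t)"
        unfolding s using z by simp
      have pos: "0 < P (?s @ [?b])" "0 < P ?s"
        unfolding sb using Cons.prems(3) P_positive_append(1)[of "take n (a # y @ t)" "drop n (a # y @ t)" for n]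
        by (metis append_Cons append_take_drop_id)+
      have "((g, ?s), \<delta> (g, ?s) ?b) \<in> ?rel"
        using Cons.prems pos by (auto simp: p_def Q_def)
      moreover have "\<delta> (g, ?s) ?b = (g \<otimes> \<phi> [a], take R ?z)"
        unfolding \<delta>_def s using z by simp
      moreover have "((g \<otimes> \<phi> [a], take R ?z), (g \<otimes> \<phi> [a] \<otimes> \<phi> y, t)) \<in> ?rel\<^sup>*"
        using Cons.prems P_positive_append(2)[of "[a]" "y @ t"] by (intro Cons.IH) auto
      ultimately show ?case
        using Cons.prems(1) by (simp add: phi_Cons[of a y] m_assoc converse_rtrancl_into_rtrancl)
    qed
    show "(q, q') \<in> ?rel\<^sup>*" if "q \<in> Q" "q' \<in> Q" for q q'
    proof -
      obtain g s h t where q: "q = (g, s)" "g \<in> carrier G" "length s = R" "0 < P s"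
        and q': "q' = (h, t)" "h \<in> carrier G" "length t = R" "0 < P t"
        using \<open>q \<in> Q\<close> \<open>q' \<in> Q\<close> by (auto simp: Q_def)
      \<comment> \<open>Sliding along \<open>s @ w\<close> multiplies the group coordinate by its
        image, so that image has to be \<open>inv g \<otimes> h\<close>.\<close>
      obtain w where w: "0 < P (s @ w @ t)" "\<phi> (s @ w) = inv g \<otimes> h"
        using irreducible_all_values[OF q(4) q'(4), of "inv g \<otimes> h"] q q' by auto
      have "g \<otimes> \<phi> (s @ w) = h"
        using w(2) q(2) q'(2) by (simp flip: m_assoc)
      then show ?thesis
        using path[of g t "s @ w"] q q' w(1) by simp
    qed
  next
    show "f (Suc n) q = (\<Sum>b\<in>UNIV. p q b * f n (\<delta> q b))" if "q \<in> Q" for n q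
    proof -
      obtain g s where q: "q = (g, s)" "g \<in> carrier G" "length s = R" "0 < P s"
        using \<open>q \<in> Q\<close> by (auto simp: Q_def)
      obtain a s' where s: "s = a # s'"
        using q(3) R by (cases s) auto
      \<comment> \<open>Splitting by the next letter \<open>b\<close> lengthens the word to
        \<open>R + 1\<close>; after one step the remaining block \<open>s' @ [b]\<close> has length
        \<open>R\<close> again, enough for the Markov property.\<close>
      have summand: "measure M (cyl g (s @ [b]) \<inter> T -` pre n) = P (s @ [b]) * f n (\<delta> q b)" for b
      proof -
        let ?t = "s' @ [b]"
        have mk: "P ?t * measure M (cyl g (s @ [b]) \<inter> T -` pre n)
            = P (s @ [b]) * measure M (cyl (g \<otimes> \<phi> [a]) ?t \<inter> pre n)"
          using measure_cyl_markov[OF q(2) _ pre(1), of ?t a n] q(3) R by (simp add: s)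
        show ?thesis
        proof (cases "P ?t = 0")
          case True
          then have "P (s @ [b]) = 0"
            using P_append_le(2)[of "[a]" ?t] P_nonneg[of "s @ [b]"] by (simp add: s)
          moreover from this have "measure M (cyl g (s @ [b])) = 0"
            using q(2) by (simp add: measure_cyl)
          then have "measure M (cyl g (s @ [b]) \<inter> T -` pre n) = 0"
            using M.finite_measure_mono[of "cyl g (s @ [b]) \<inter> T -` pre n" "cyl g (s @ [b])"] q(2)
            by (simp add: measure_le_0_iff)
          ultimately show ?thesis
            by simp
        next
          case False
          then show ?thesis
            using mk by (simp add: q(1) s f_def \<delta>_def field_simps)
        qed
      qed
      have "cyl g s \<inter> pre (Suc n) = cyl g s \<inter> T -` pre n"
        using cyl_space[OF q(2)] by (auto simp: pre_Suc)
      moreover have "cyl g s \<inter> pre (Suc n) \<in> sets M"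
        using q(2) pre(2) by auto
      ultimately have "measure M (cyl g s \<inter> pre (Suc n)) = (\<Sum>b\<in>UNIV. P (s @ [b]) * f n (\<delta> q b))"
        using measure_cyl_snoc[OF q(2), of s "T -` pre n"] by (simp add: summand)
      then show ?thesis
        by (simp add: q(1) f_def[of "Suc n"] p_def sum_divide_distrib)
    qed
  next
    show "\<bar>f n q\<bar> \<le> 1" if "q \<in> Q" for n q
    proof -
      obtain g s where q: "q = (g, s)" "g \<in> carrier G" "0 < P s"
        using \<open>q \<in> Q\<close> by (auto simp: Q_def)
      have "measure M (cyl g s \<inter> pre n) \<le> measure M (cyl g s)"
        using q(2) by (intro M.finite_measure_mono) auto
      also have "\<dots> \<le> P s"
        using N_pos q by (simp add: measure_cyl field_simps)
      finally show ?thesis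
        using q by (simp add: f_def)
    qed
  next
    show "(\<Sum>q\<in>Q. P (snd q)) \<noteq> 0"
      using N_pos by (simp add: weight)
  next
    \<comment> \<open>Stationarity: weighting by \<open>P s\<close> undoes the division in
      \<open>f\<close>, which leaves the measure of T^-n D, equal to that of
      \<open>D\<close>.\<close>
    fix n
    have "(\<Sum>q\<in>Q. P (snd q) * f n q) = (\<Sum>(g, s)\<in>Q. measure M (cyl g s \<inter> pre n))"
      by (intro sum.cong) (auto simp: Q_def f_def)
    also have "\<dots> = measure M D"
      using sum_Q[OF pre(2)[of n]] invariant_under_measure_vimage[OF invariant_under_funpow[OF invariant_T] sets_future[OF D]]
      by (simp add: pre_def)
    finally show "(\<Sum>q\<in>Q. P (snd q) * f n q) = measure M D" .
  next
    show "(g, u) \<in> Q"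
      using g False P_nonneg[of u] by (simp add: Q_def R_def less_le)
  qed
  then have "cesaro_to (\<lambda>n. P u * f n (g, u)) (P u * (measure M D / N))"
    unfolding weight by (rule cesaro_to_cmult)
  moreover have "P u * f n (g, u) = measure M (cyl g u \<inter> (T ^^ n) -` D)" for n
  proof -
    have "cyl g u \<inter> pre n = cyl g u \<inter> (T ^^ n) -` D"
      using cyl_space[OF g] by (auto simp: pre_def)
    then show ?thesis
      using False by (simp add: f_def)
  qed
  ultimately show ?thesis
    by (simp add: measure_cyl[OF g])
qed

lemma cesaro_future_future:
  assumes C: "future C" and D: "future D"
  shows "cesaro_to (\<lambda>n. measure M (C \<inter> (T ^^ n) -` D)) (measure M C * measure M D)"
proof -
  \<comment> \<open>Padding to at least \<open>Suc r\<close> letters makes the words long enough for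
    the Markov property and also non-empty.\<close>
  obtain m W where m: "Suc r \<le> m" and CW: "C = fut m W"
    using future_ge[OF C] by blast
  let ?I = "(carrier G \<times> {s. length s = m}) \<inter> W"
  have decomp: "measure M (C \<inter> E) = (\<Sum>q\<in>?I. measure M (cyl (fst q) (snd q) \<inter> E))"
    if E: "C \<inter> E \<in> sets M" for E
  proof -
    have "cyl g s \<inter> (C \<inter> E) = (if (g, s) \<in> W then cyl g s \<inter> E else {})"
      if "g \<in> carrier G" "length s = m" for g s
      using that by (auto simp: CW cyl_def fut_def)
    then have "(\<Sum>(g, s)\<in>carrier G \<times> {s. length s = m}. measure M (cyl g s \<inter> (C \<inter> E)))
        = (\<Sum>q\<in>carrier G \<times> {s. length s = m}. if q \<in> W then measure M (cyl (fst q) (snd q) \<inter> E) else 0)"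
      by (intro sum.cong) auto
    also have "\<dots> = (\<Sum>q\<in>?I. measure M (cyl (fst q) (snd q) \<inter> E))"
      by (intro sum.inter_restrict[symmetric] finite_cartesian_product fin finite_words)
    finally show ?thesis
      using measure_partition_cyl[OF E, of m] by simp
  qed
  have "cesaro_to (\<lambda>n. \<Sum>q\<in>?I. measure M (cyl (fst q) (snd q) \<inter> (T ^^ n) -` D))
      (\<Sum>q\<in>?I. measure M (cyl (fst q) (snd q)) * measure M D)"
    using m by (intro cesaro_to_sum cesaro_cyl_future D) auto
  moreover have "measure M (C \<inter> (T ^^ n) -` D)
      = (\<Sum>q\<in>?I. measure M (cyl (fst q) (snd q) \<inter> (T ^^ n) -` D))" for n
  proof (rule decomp)
    have "C \<inter> (T ^^ n) -` D = C \<inter> ((T ^^ n) -` D \<inter> space M)"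
      using sets.sets_into_space[OF sets_future[OF C]] by auto
    then show "C \<inter> (T ^^ n) -` D \<in> sets M"
      using sets_future[OF C] sets_future[OF future_vimage_funpow[OF D, of n]] by simp
  qed
  moreover have "measure M C = (\<Sum>q\<in>?I. measure M (cyl (fst q) (snd q)))"
    using decomp[of UNIV] sets_future[OF C] by simp
  ultimately show ?thesis
    by (simp add: sum_distrib_right)
qed

section \<open>Two-sided cylinders as a generator\<close>

lemma T_funpow:
  assumes "g \<in> carrier G"
  shows "(T ^^ n) (g, x) = (g \<otimes> \<phi> (factor x 0 (int n)), \<lambda>k. x (k + int n))"
proof (induction n)
  case (Suc n)
  then show ?case
    using assms
    by (simp add: skew_map_def shift_map_def factor_snoc phi_append m_assoc add_ac del: of_nat_Suc)
       (simp add: add_ac)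
qed (use assms in simp)

text \<open>Two-sided cylinder sets, described by the fact that a preimage under a large enough power of \<open>T\<close>
  depends only on the nonnegative coordinates.\<close>

definition cylinder_sets :: "('g \<times> (int \<Rightarrow> 'a)) set set" where
  "cylinder_sets = {C \<in> sets M. \<exists>j. future ((T ^^ j) -` C \<inter> space M)}"

lemma vimage_add: "(T ^^ (i + j)) -` E \<inter> space M = (T ^^ i) -` ((T ^^ j) -` E \<inter> space M) \<inter> space M"
  using measurable_space[OF measurable_funpow[OF measurable_T]]
  by (auto simp: add.commute[of i] funpow_add)

lemma cylinder_sets_common:
  assumes "C \<in> cylinder_sets" "D \<in> cylinder_sets"
  shows "\<exists>j. future ((T ^^ j) -` C \<inter> space M) \<and> future ((T ^^ j) -` D \<inter> space M)"
proof -
  obtain i j where "future ((T ^^ i) -` C \<inter> space M)" "future ((T ^^ j) -` D \<inter> space M)"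
    using assms by (auto simp: cylinder_sets_def)
  then have "future ((T ^^ (j + i)) -` C \<inter> space M)" "future ((T ^^ (i + j)) -` D \<inter> space M)"
    unfolding vimage_add by (blast intro: future_vimage_funpow)+
  then show ?thesis
    by (metis add.commute)
qed

lemma future_Int:
  assumes "future C" "future D"
  shows "future (C \<inter> D)"
proof -
  obtain m V where C: "C = fut m V"
    using assms by (auto simp: future_def)
  obtain n W where n: "n \<ge> m" and D: "D = fut n W"
    using future_ge[OF assms(2)] by blast
  have "C \<inter> D = fut n {(g, w). (g, take m w) \<in> V \<and> (g, w) \<in> W}"
    using take_factor[of 0 "int m" "int n", where 'a = 'a] n by (auto simp: C D fut_def)
  then show ?thesis
    by (auto simp: future_def)
qed

lemma Int_stable_cylinder_sets: "Int_stable cylinder_sets"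
proof (rule Int_stableI)
  fix C D assume CD: "C \<in> cylinder_sets" "D \<in> cylinder_sets"
  then obtain j where "future ((T ^^ j) -` C \<inter> space M)" "future ((T ^^ j) -` D \<inter> space M)"
    using cylinder_sets_common by blast
  then have "future (((T ^^ j) -` C \<inter> space M) \<inter> ((T ^^ j) -` D \<inter> space M))"
    by (rule future_Int)
  also have "((T ^^ j) -` C \<inter> space M) \<inter> ((T ^^ j) -` D \<inter> space M) = (T ^^ j) -` (C \<inter> D) \<inter> space M"
    by auto
  finally show "C \<inter> D \<in> cylinder_sets"
    using CD by (auto simp: cylinder_sets_def)
qed

text \<open>T^-j (C \<inter> T^-n D) equals T^-j C \<inter> T^-n (T^-j D), and taking T^-j does not
  change measures; so the claim passes to two future events.\<close>

lemma cesaro_cylinder_sets: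
  assumes "C \<in> cylinder_sets" "D \<in> cylinder_sets"
  shows "cesaro_to (\<lambda>n. measure M (C \<inter> (T ^^ n) -` D)) (measure M C * measure M D)"
proof -
  obtain j where j: "future ((T ^^ j) -` C \<inter> space M)" "future ((T ^^ j) -` D \<inter> space M)"
    using cylinder_sets_common[OF assms] by blast
  have CD: "C \<in> sets M" "D \<in> sets M"
    using assms by (auto simp: cylinder_sets_def)
  have inv: "measure M ((T ^^ j) -` E \<inter> space M) = measure M E" if "E \<in> sets M" for E
    by (rule invariant_under_measure_vimage[OF invariant_under_funpow[OF invariant_T] that])
  have "measure M ((T ^^ j) -` C \<inter> space M \<inter> (T ^^ n) -` ((T ^^ j) -` D \<inter> space M))
      = measure M (C \<inter> (T ^^ n) -` D)" for n
  proof -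
    have "(T ^^ j) -` C \<inter> space M \<inter> (T ^^ n) -` ((T ^^ j) -` D \<inter> space M)
        = (T ^^ j) -` C \<inter> ((T ^^ (n + j)) -` D \<inter> space M)"
      unfolding vimage_add by auto
    also have "\<dots> = (T ^^ j) -` (C \<inter> ((T ^^ n) -` D \<inter> space M)) \<inter> space M"
      unfolding add.commute[of n] vimage_add by auto
    also have "measure M \<dots> = measure M (C \<inter> ((T ^^ n) -` D \<inter> space M))"
      using CD measurable_sets[OF measurable_funpow[OF measurable_T]] by (intro inv) auto
    also have "C \<inter> ((T ^^ n) -` D \<inter> space M) = C \<inter> (T ^^ n) -` D"
      using sets.sets_into_space[OF CD(1)] by auto
    finally show ?thesis .
  qed
  then show ?thesis
    using cesaro_future_future[OF j] CD by (simp add: inv)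
qed

lemma coordinate_cylinder_set: "carrier G \<times> {x \<in> S. x i \<in> A} \<in> cylinder_sets"
proof -
  \<comment> \<open>The least shift that brings coordinate \<open>i\<close> to a non-negative
    position \<open>k\<close>; it is 0 when \<open>i\<close> is non-negative already.\<close>
  define j where "j = nat (- i)"
  define k where "k = nat (i + int j)"
  have k: "int k = i + int j"
    by (simp add: k_def j_def)
  have nth: "factor x 0 (int (Suc k)) ! k = x (i + int j)" for x :: "int \<Rightarrow> 'a"
    by (simp add: factor_snoc nth_append del: of_nat_Suc flip: k)
  have supp: "snd ((T ^^ j) z) \<in> S" if "z \<in> space M" for z
    using measurable_space[OF measurable_funpow[OF measurable_T] that, of j]
    by (auto simp: space_M mem_Times_iff)
  have "(T ^^ j) -` (carrier G \<times> {x \<in> S. x i \<in> A}) \<inter> space M = fut (Suc k) {(g, w). w ! k \<in> A}"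
    using supp by (auto simp: fut_def space_M T_funpow nth simp del: of_nat_Suc)
  then have "future ((T ^^ j) -` (carrier G \<times> {x \<in> S. x i \<in> A}) \<inter> space M)"
    by (auto simp: future_def)
  moreover have "carrier G \<times> {x \<in> S. x i \<in> A} \<in> sets M"
    using sets_factor[of "\<lambda>w. hd w \<in> A" i "i + 1"]
    by (intro sets_Times_M sets_support_Collect) auto
  ultimately show ?thesis
    by (auto simp: cylinder_sets_def)
qed

text \<open>For the non-trivial inclusion, the identity is shown measurable from the generated
  sigma-algebra to \<open>M\<close>, one factor of the product at a time.\<close>

lemma sets_M_generated: "sets M = sigma_sets (space M) cylinder_sets"
proof (rule antisym)
  show "sigma_sets (space M) cylinder_sets \<subseteq> sets M"
    by (rule sets.sigma_sets_subset) (auto simp: cylinder_sets_def)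
  let ?\<Sigma> = "sigma (space M) cylinder_sets"
  have sub: "cylinder_sets \<subseteq> Pow (space M)"
    using sets.sets_into_space by (auto simp: cylinder_sets_def)
  have gen: "C \<in> sets ?\<Sigma>" if "C \<in> cylinder_sets" for C
    using that sub by (simp add: sigma_sets.Basic)
  have "fst -` {g} \<inter> space ?\<Sigma> \<in> sets ?\<Sigma>" for g
  proof (rule gen)
    \<comment> \<open>A fibre reads no letters, hence length 0; for \<open>g\<close> outside the
      group both sides are empty.\<close>
    have "fst -` {g} \<inter> space ?\<Sigma> = fut 0 ({g} \<times> UNIV)"
      using sub by (auto simp: fut_def space_M)
    moreover have "(T ^^ 0) -` fut 0 ({g} \<times> UNIV) \<inter> space M = fut 0 ({g} \<times> UNIV)"
      by (auto simp: fut_def space_M)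
    then have "future ((T ^^ 0) -` fut 0 ({g} \<times> UNIV) \<inter> space M)"
      unfolding future_def by blast
    ultimately show "fst -` {g} \<inter> space ?\<Sigma> \<in> cylinder_sets"
      unfolding cylinder_sets_def by (metis (mono_tags, lifting) mem_Collect_eq sets_fut)
  qed
  then have "fst \<in> measurable ?\<Sigma> (count_space (carrier G))"
    using fin sub by (subst measurable_count_space_eq2) (auto simp: space_M)
  then have fst: "fst \<in> measurable ?\<Sigma> (uniform_count_measure (carrier G))"
    by (simp add: measurable_cong_sets[OF refl sets_uniform_count_measure_count_space])
  have "snd \<in> measurable ?\<Sigma> full_shift"
  proof (rule measurable_PiM_single)
    fix A :: "'a set" and i :: int
    have "{z \<in> space ?\<Sigma>. snd z i \<in> A} = carrier G \<times> {x \<in> S. x i \<in> A}"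
      using sub by (auto simp: space_M)
    then show "{z \<in> space ?\<Sigma>. snd z i \<in> A} \<in> sets ?\<Sigma>"
      using gen[OF coordinate_cylinder_set] by simp
  qed auto
  then have "snd \<in> measurable ?\<Sigma> \<mu>"
    by (simp add: measurable_cong_sets[OF refl sets_eq])
  then have "snd \<in> measurable ?\<Sigma> (restrict_space \<mu> S)"
    using sub by (intro measurable_restrict_space2) (auto simp: space_M)
  with fst have id: "(\<lambda>z. (fst z, snd z)) \<in> measurable ?\<Sigma> M"
    unfolding skew_measure_def by (rule measurable_Pair)
  show "sets M \<subseteq> sigma_sets (space M) cylinder_sets"
  proof
    fix E assume E: "E \<in> sets M"
    have "E = (\<lambda>z. (fst z, snd z)) -` E \<inter> space ?\<Sigma>"
      using sub sets.sets_into_space[OF E] by auto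
    also have "\<dots> \<in> sets ?\<Sigma>"
      by (rule measurable_sets[OF id E])
    finally show "E \<in> sigma_sets (space M) cylinder_sets"
      using sub by simp
  qed
qed

section \<open>Ergodicity and density\<close>

lemma cesaro_mixing:
  assumes "C \<in> sets M" "D \<in> sets M"
  shows "cesaro_to (\<lambda>n. measure M (C \<inter> (T ^^ n) -` D)) (measure M C * measure M D)"
  using sets.sets_into_space
  by (intro cesaro_mixing_generator[OF prob_space_M invariant_T Int_stable_cylinder_sets _
        sets_M_generated cesaro_cylinder_sets assms])
     (auto simp: cylinder_sets_def)

theorem ergodic_skew_product: "ergodic M T"
  by (rule cesaro_mixing_imp_ergodic[OF prob_space_M invariant_T cesaro_mixing])

text \<open>Starting from \<open>\<one>\<close>, the group coordinate after n steps is the image of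
  the first n letters, so hitting \<open>K\<close> at time n means that this prefix lies in the
  language. The fibre over \<open>\<one>\<close> has mass 1/N, which the final multiplication by
  \<open>N\<close> cancels.\<close>

theorem language_density:
  assumes K: "K \<subseteq> carrier G"
  shows "has_language_density \<mu> (\<phi> -` K) (real (card K) / N)"
proof -
  let ?E = "\<lambda>n. {x \<in> S. factor x 0 (int n) \<in> \<phi> -` K}"
  have S: "S \<in> sets \<mu>" "measure \<mu> S = 1"
    using sets_measure_support AE_in_measure_support by (simp_all add: prob_eq_1)
  have E: "?E n \<in> sets \<mu>" for n
    by (intro sets_support_Collect sets_factor)
  have "measure M (({\<one>} \<times> S) \<inter> (T ^^ n) -` (K \<times> S)) = measure \<mu> (?E n) / N" for n
  proof -
    have "snd ((T ^^ n) (\<one>, x)) \<in> S" if "x \<in> S" for x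
      using that measurable_space[OF measurable_funpow[OF measurable_T], of "(\<one>, x)" n]
      by (auto simp: space_M mem_Times_iff)
    then have "({\<one>} \<times> S) \<inter> (T ^^ n) -` (K \<times> S) = {\<one>} \<times> ?E n"
      by (auto simp: T_funpow)
    then show ?thesis
      using measure_M_Times[of "{\<one>}" "?E n"] E by auto
  qed
  moreover have "measure M ({\<one>} \<times> S) = 1 / N" "measure M (K \<times> S) = real (card K) / N"
    using measure_M_Times[of "{\<one>}" S] measure_M_Times[of K S] S K by simp_all
  moreover have "{\<one>} \<times> S \<in> sets M" "K \<times> S \<in> sets M"
    using S K by (auto intro: sets_Times_M)
  ultimately have "cesaro_to (\<lambda>n. measure \<mu> (?E n) / N) (1 / N * (real (card K) / N))"
    using cesaro_mixing[of "{\<one>} \<times> S" "K \<times> S"] by simp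
  then have "cesaro_to (\<lambda>n. measure \<mu> (?E n)) (real (card K) / N)"
    using cesaro_to_cmult[of "\<lambda>n. measure \<mu> (?E n) / N" "1 / N * (real (card K) / N)" N] N_pos by simp
  then show ?thesis
    by (simp add: cesaro_to_def has_language_density_def)
qed

end

theorem theorem1p2:
  fixes \<mu> :: "(int \<Rightarrow> 'a::finite) measure" and r :: nat
    and X :: "(int \<Rightarrow> 'a) set"
    and G :: "('g, 'b) monoid_scheme" and \<phi> :: "'a list \<Rightarrow> 'g"
  assumes "sets \<mu> = sets full_shift" and "prob_space \<mu>"
    and "invariant_under \<mu> shift_map"
    and "r \<ge> 1" and "markov_measure r \<mu>"
    and "X = measure_support \<mu>"
    and "\<forall>a. \<exists>x\<in>X. \<exists>n. x n = a"
    and "group G" and "finite (carrier G)"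
    and "\<phi> \<in> epi word_monoid G" and "\<phi> [] = \<one>\<^bsub>G\<^esub>"
    and "morphism_irreducible G \<phi> X"
  shows "ergodic (skew_measure G \<mu>) (skew_map G \<phi>) \<and>
    (\<forall>K. K \<subseteq> carrier G \<longrightarrow>
       has_language_density \<mu> (\<phi> -` K) (real (card K) / real (card (carrier G))))"
proof -
  interpret markov_skew_product \<mu> r G \<phi>
    using assms
    by (intro markov_skew_product.intro markov_shift.intro markov_shift_axioms.intro
        markov_skew_product_axioms.intro) simp_all
  show ?thesis
    using ergodic_skew_product language_density by blast
qed

end
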